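(* Let $X$ be a locally compact Hausdorff space, $\mu$ a Borel measure on $X$, $\mathcal{A}$ a unital $C^*$-algebra, and $a,b\in C_b(X,\mathcal{A})$ densities such that $a(x)$ and $b(x)$ are invertible in $\mathcal{A}$ for every $x\in X$. Then $$\int_X a^*\,\log\big((a^* )^{-1}\,b^*\,b\,a^{-1}\big)\,a\;d\mu\leq 0.$$
   Context: $C_b(X,\mathcal{A})$ is the $C^*$-algebra of norm-continuous, norm-bounded functions $X\to\mathcal{A}$ with pointwise operations. A function $g$ with $x\mapsto\|g(x)\|$ integrable is called integrable, and $\int_X g\,d\mu$ denotes its Bochner integral. A function $d\in C_b(X,\mathcal{A})$ is a density if $d^*d$ is integrable and $\int_X d^*(x)d(x)\,d\mu(x)=I$, the unit of $\mathcal{A}$. In the claim, the integrand is the function $x\mapsto a(x)^*\log\big((a(x)^* )^{-1}b(x)^*b(x)a(x)^{-1}\big)a(x)$, with $\log$ defined by functional calculus, and the integral is the Bochner integral. *)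

theory Defs
  imports "HOL-Analysis.Analysis"
begin

section \<open>Unital C*-algebras\<close>

class scaleC =
  fixes scaleC :: "complex \<Rightarrow> 'a \<Rightarrow> 'a"  (infixr \<open>*\<^sub>C\<close> 75)

class star =
  fixes star :: "'a \<Rightarrow> 'a"

(* The class real_normed_algebra_1 includes 0 \<noteq> 1 and norm 1 = 1, so the zero algebra is
   not an instance; every other unital C*-algebra is. *)
class cstar_algebra_1 = real_normed_algebra_1 + banach + scaleC + star +
  assumes scaleC_add_right: "c *\<^sub>C (x + y) = c *\<^sub>C x + c *\<^sub>C y"
    and scaleC_add_left: "(c + d) *\<^sub>C x = c *\<^sub>C x + d *\<^sub>C x"
    and scaleC_scaleC: "c *\<^sub>C (d *\<^sub>C x) = (c * d) *\<^sub>C x"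
    and scaleC_of_real: "of_real r *\<^sub>C x = r *\<^sub>R x"
    and mult_scaleC_left: "(c *\<^sub>C x) * y = c *\<^sub>C (x * y)"
    and mult_scaleC_right: "x * (c *\<^sub>C y) = c *\<^sub>C (x * y)"
    and norm_scaleC: "norm (c *\<^sub>C x) = cmod c * norm x"
    and star_star: "star (star x) = x"
    and star_add: "star (x + y) = star x + star y"
    and star_scaleC: "star (c *\<^sub>C x) = cnj c *\<^sub>C star x"
    and star_mult: "star (x * y) = star y * star x"
    and cstar_identity: "norm (star x * x) = (norm x)\<^sup>2"

definition alg_invertible :: "'a::monoid_mult \<Rightarrow> bool" where
  "alg_invertible x \<longleftrightarrow> (\<exists>y. x * y = 1 \<and> y * x = 1)"

(* Arbitrary if x is not invertible. *)
definition alg_inv :: "'a::monoid_mult \<Rightarrow> 'a" where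
  "alg_inv x = (THE y. x * y = 1 \<and> y * x = 1)"

definition spectrum :: "'a::cstar_algebra_1 \<Rightarrow> complex set" where
  "spectrum x = {z. \<not> alg_invertible (x - z *\<^sub>C 1)}"

definition cstar_positive :: "'a::cstar_algebra_1 \<Rightarrow> bool" where
  "cstar_positive x \<longleftrightarrow> star x = x \<and> spectrum x \<subseteq> complex_of_real ` {0..}"

definition cstar_le :: "'a::cstar_algebra_1 \<Rightarrow> 'a \<Rightarrow> bool"  (infix \<open>\<preceq>\<close> 50) where
  "x \<preceq> y \<longleftrightarrow> cstar_positive (y - x)"


section \<open>Continuous functional calculus\<close>

(* \<Phi> is a unital *-homomorphism from C(spectrum h) to the algebra that maps the inclusion
   function to h. Elements of C(spectrum h) are represented by functions on all of the complex
   plane that are continuous on spectrum h, identified when they agree there. *)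
definition functional_calculus ::
    "'a::cstar_algebra_1 \<Rightarrow> ((complex \<Rightarrow> complex) \<Rightarrow> 'a) \<Rightarrow> bool" where
  "functional_calculus h \<Phi> \<longleftrightarrow>
     (\<forall>f g. continuous_on (spectrum h) f \<longrightarrow> continuous_on (spectrum h) g \<longrightarrow>
        ((\<forall>z\<in>spectrum h. f z = g z) \<longrightarrow> \<Phi> f = \<Phi> g) \<and>
        \<Phi> (\<lambda>z. f z + g z) = \<Phi> f + \<Phi> g \<and>
        \<Phi> (\<lambda>z. f z * g z) = \<Phi> f * \<Phi> g) \<and>
     (\<forall>c f. continuous_on (spectrum h) f \<longrightarrow>
        \<Phi> (\<lambda>z. c * f z) = c *\<^sub>C \<Phi> f \<and>
        \<Phi> (\<lambda>z. cnj (f z)) = star (\<Phi> f)) \<and>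
     \<Phi> (\<lambda>z. 1) = 1 \<and>
     \<Phi> (\<lambda>z. z) = h"

(* Meaningful for normal h and f continuous on spectrum h: then some \<Phi> exists, and its value
   at f does not depend on the choice, since *-homomorphisms are contractive and the
   polynomials in z and cnj z are dense. *)
definition cfc :: "'a::cstar_algebra_1 \<Rightarrow> (complex \<Rightarrow> complex) \<Rightarrow> 'a" where
  "cfc h f = (SOME \<Phi>. functional_calculus h \<Phi>) f"

(* Complex ln is the principal branch, hence the real logarithm on the spectrum of a positive
   invertible element. *)
definition cstar_log :: "'a::cstar_algebra_1 \<Rightarrow> 'a" where
  "cstar_log h = cfc h ln"


section \<open>Bochner integral in an arbitrary Banach space\<close>

(* The definitions of has_bochner_integral and lebesgue_integral from HOL-Analysis without the
   sort constraint second_countable_topology, which would force the algebra to be separable.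
   As there, the integral of a function without a Bochner integral is 0. *)
inductive has_banach_integral ::
    "'x measure \<Rightarrow> ('x \<Rightarrow> 'b) \<Rightarrow> 'b::real_normed_vector \<Rightarrow> bool" for M f J where
  "f \<in> borel_measurable M \<Longrightarrow>
    (\<And>i. Bochner_Integration.simple_bochner_integrable M (s i)) \<Longrightarrow>
    (\<lambda>i. \<integral>\<^sup>+x. norm (f x - s i x) \<partial>M) \<longlonglongrightarrow> 0 \<Longrightarrow>
    (\<lambda>i. Bochner_Integration.simple_bochner_integral M (s i)) \<longlonglongrightarrow> J \<Longrightarrow>
    has_banach_integral M f J"

definition banach_integral :: "'x measure \<Rightarrow> ('x \<Rightarrow> 'b::real_normed_vector) \<Rightarrow> 'b" where
  "banach_integral M f =
     (if \<exists>J. has_banach_integral M f J then THE J. has_banach_integral M f J else 0)"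

lemma has_banach_integral_eq_has_bochner_integral:
  fixes f :: "'x \<Rightarrow> 'b::{real_normed_vector, second_countable_topology}"
  shows "has_banach_integral M f J \<longleftrightarrow> has_bochner_integral M f J"
  unfolding has_banach_integral.simps has_bochner_integral.simps ..


section \<open>Densities\<close>

(* Since 0 \<noteq> 1, the second conjunct also says that the Bochner integral exists. *)
definition density_in :: "'x::topological_space measure \<Rightarrow> ('x \<Rightarrow>\<^sub>C 'a::cstar_algebra_1) \<Rightarrow> bool" where
  "density_in \<mu> d \<longleftrightarrow>
     integrable \<mu> (\<lambda>x. norm (star (d x) * d x)) \<and>
     banach_integral \<mu> (\<lambda>x. star (d x) * d x) = 1"

end

theory Submission
  imports Defs "HOL-Computational_Algebra.Fundamental_Theorem_Algebra"
begin

text \<open>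
  Put \<open>h = (a\<^sup>*)\<^sup>-\<^sup>1 b\<^sup>* b a\<^sup>-\<^sup>1\<close>, which is positive and invertible. The scalar inequality
  \<open>ln t \<le> t - 1\<close> gives \<open>log h \<preceq> h - 1\<close>, hence \<open>a\<^sup>* (log h) a \<preceq> b\<^sup>* b - a\<^sup>* a\<close> pointwise
  (\<open>cstar_positive_relative_log\<close>). The right-hand side has integral \<open>1 - 1 = 0\<close>, and integration
  preserves the order because the positive elements form a closed convex cone
  (\<open>has_upper_integral_in_cone\<close>).

  The pointwise inequality rests on the existence of the continuous functional calculus of a
  self-adjoint element (\<open>functional_calculus_exists\<close>) and on the positivity of \<open>x\<^sup>* x\<close>
  (\<open>cstar_positive_star_mult\<close>), which also shows that \<open>h\<close> is positive. The functional calculus is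
  obtained by extending the polynomial calculus along uniform limits on the spectrum; the necessary
  estimate is that the norm of a self-adjoint element is attained on its spectrum
  (\<open>spectrum_meets_unit_circle\<close>), which is proved by an elementary averaging argument.

  The algebra may be nonseparable, so differences of Borel functions need not be Borel. The
  integrals are therefore combined through \<open>has_upper_integral\<close>, which asks for measurable bounds
  on the approximation errors only.
\<close>

section \<open>Elementary spectral theory\<close>

interpretation scaleC: vector_space "scaleC :: complex \<Rightarrow> 'a \<Rightarrow> 'a::cstar_algebra_1"
proof
  show "1 *\<^sub>C x = x" for x :: 'a
    using scaleC_of_real[of 1 x] by simp
qed (simp_all add: scaleC_add_right scaleC_add_left scaleC_scaleC)

lemma star_zero [simp]: "star (0::'a::cstar_algebra_1) = 0"
  using star_add[of "0::'a" 0] by simp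

lemma star_minus: "star (- x) = - star (x::'a::cstar_algebra_1)"
  using star_add[of x "- x"] by (simp add: eq_neg_iff_add_eq_0 add.commute)

lemma star_diff: "star (x - y) = star x - star (y::'a::cstar_algebra_1)"
  using star_add[of x "- y"] by (simp add: star_minus)

lemma star_one [simp]: "star (1::'a::cstar_algebra_1) = 1"
  using star_mult[of "star (1::'a)" 1] by (simp add: star_star)

lemma star_scaleR: "star (r *\<^sub>R x) = r *\<^sub>R star (x::'a::cstar_algebra_1)"
  by (metis complex_cnj_complex_of_real scaleC_of_real star_scaleC)

lemma star_power: "star (x ^ n) = star (x::'a::cstar_algebra_1) ^ n"
  by (induction n) (simp_all add: star_mult power_commutes)

lemma norm_star [simp]: "norm (star x) = norm (x::'a::cstar_algebra_1)"
proof -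
  have *: "norm x \<le> norm (star x)" for x :: 'a
  proof (cases "x = 0")
    case False
    have "norm x * norm x \<le> norm (star x) * norm x"
      using cstar_identity[of x] norm_mult_ineq[of "star x" x] by (simp add: power2_eq_square)
    with False show ?thesis by simp
  qed simp
  from *[of x] *[of "star x"] show ?thesis by (simp add: star_star)
qed

lemma norm_scaleC_one [simp]: "norm (c *\<^sub>C (1::'a::cstar_algebra_1)) = cmod c"
  by (simp add: norm_scaleC)

lemma power_scaleC: "(c *\<^sub>C x) ^ n = (c ^ n) *\<^sub>C (x::'a::cstar_algebra_1) ^ n"
  by (induction n) (simp_all add: mult_scaleC_left mult_scaleC_right scaleC_scaleC mult.commute)

lemma norm_selfadjoint_power_two_power:
  fixes x :: "'a::cstar_algebra_1"
  assumes "star x = x"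
  shows "norm (x ^ 2 ^ m) = norm x ^ 2 ^ m"
proof (induction m)
  case (Suc m)
  have "x ^ 2 ^ Suc m = star (x ^ 2 ^ m) * x ^ 2 ^ m"
    by (simp add: star_power assms mult_2 power_add)
  then show ?case
    by (simp only: cstar_identity Suc power_Suc mult.commute[of 2] power_mult)
qed simp

lemma alg_inv_eq:
  fixes x :: "'a::monoid_mult"
  assumes "x * y = 1" "y * x = 1"
  shows "alg_inv x = y"
  unfolding alg_inv_def
proof (rule the_equality)
  fix z assume "x * z = 1 \<and> z * x = 1"
  then have "z = (y * x) * z" by (simp add: assms)
  also have "\<dots> = y" using \<open>x * z = 1 \<and> z * x = 1\<close> by (simp add: mult.assoc)
  finally show "z = y" .
qed (use assms in simp)

lemma alg_inv_inverse:
  fixes x :: "'a::monoid_mult"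
  assumes "alg_invertible x"
  shows "x * alg_inv x = 1" "alg_inv x * x = 1"
  using assms alg_inv_eq unfolding alg_invertible_def by metis+

lemma alg_invertible_mult:
  fixes x y :: "'a::monoid_mult"
  assumes "alg_invertible x" "alg_invertible y"
  shows "alg_invertible (x * y)"
proof -
  have "x * y * (alg_inv y * alg_inv x) = x * (y * alg_inv y) * alg_inv x"
    by (simp only: mult.assoc)
  moreover have "alg_inv y * alg_inv x * (x * y) = alg_inv y * (alg_inv x * x) * y"
    by (simp only: mult.assoc)
  ultimately show ?thesis
    unfolding alg_invertible_def using assms by (metis alg_inv_inverse mult_1_right)
qed

lemma alg_invertible_scaleC:
  fixes x :: "'a::cstar_algebra_1"
  assumes "alg_invertible x" "c \<noteq> 0"
  shows "alg_invertible (c *\<^sub>C x)"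
  unfolding alg_invertible_def
  by (rule exI[of _ "inverse c *\<^sub>C alg_inv x"])
     (use assms in \<open>simp add: mult_scaleC_left mult_scaleC_right scaleC_scaleC alg_inv_inverse\<close>)

lemma alg_invertible_one_minus:
  fixes x :: "'a::{real_normed_algebra_1,banach}"
  assumes "norm x < 1"
  shows "alg_invertible (1 - x)"
proof -
  have s: "summable (\<lambda>n. x ^ n)"
    by (rule complete_algebra_summable_geometric[OF assms])
  have e: "(\<Sum>n. x ^ n) = 1 + (\<Sum>n. x ^ Suc n)"
    using suminf_split_head[OF s] by simp
  have "(\<Sum>n. x ^ Suc n) = x * (\<Sum>n. x ^ n)"
    using suminf_mult[OF s, of x] by simp
  moreover have "(\<Sum>n. x ^ Suc n) = (\<Sum>n. x ^ n) * x"
    using suminf_mult2[OF s, of x] by (simp add: power_commutes)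
  ultimately show ?thesis
    unfolding alg_invertible_def using e
    by (intro exI[of _ "\<Sum>n. x ^ n"]) (simp add: algebra_simps)
qed

lemma alg_invertible_perturb:
  fixes u v w :: "'a::{real_normed_algebra_1,banach}"
  assumes "u * v = 1" "v * u = 1" "norm v * norm w < 1"
  shows "alg_invertible (u - w)"
proof -
  have "u - w = u * (1 - v * w)"
    by (simp add: right_diff_distrib assms flip: mult.assoc)
  moreover have "norm (v * w) < 1"
    using norm_mult_ineq assms(3) by (rule le_less_trans)
  moreover have "alg_invertible u"
    using assms unfolding alg_invertible_def by blast
  ultimately show ?thesis
    by (simp add: alg_invertible_mult alg_invertible_one_minus)
qed

lemma norm_inverse_diff_le:
  fixes u v :: "'a::real_normed_algebra_1"
  assumes "u * v = 1" "v * u = 1" "u' * v' = 1" "v' * u' = 1"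
    and small: "norm (u - u') * norm v \<le> 1 / 2"
  shows "norm (v' - v) \<le> 2 * (norm v)\<^sup>2 * norm (u - u')"
proof -
  have "v' - v = v' * (u - u') * v"
    using assms by (simp add: left_diff_distrib right_diff_distrib mult.assoc)
  then have le: "norm (v' - v) \<le> norm v' * (norm (u - u') * norm v)"
    by (metis mult.assoc norm_mult_ineq order_trans mult_left_mono norm_ge_zero)
  also have "\<dots> \<le> norm v' * (1 / 2)"
    by (intro mult_left_mono small norm_ge_zero)
  finally have "norm v' \<le> 2 * norm v"
    using norm_triangle_ineq2[of v' v] by simp
  with le have "norm (v' - v) \<le> 2 * norm v * (norm (u - u') * norm v)"
    by (meson mult_right_mono norm_ge_zero mult_nonneg_nonneg order_trans)
  then show ?thesis by (simp add: power2_eq_square mult_ac)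
qed

lemma spectrum_cmod_le:
  assumes "z \<in> spectrum (x::'a::cstar_algebra_1)"
  shows "cmod z \<le> norm x"
proof (rule ccontr)
  assume *: "\<not> cmod z \<le> norm x"
  then have z: "z \<noteq> 0" by auto
  have "cmod (inverse z) * norm x < cmod (inverse z) * cmod z"
    using * z by (intro mult_strict_left_mono) auto
  also have "\<dots> = 1"
    using z by (simp flip: norm_mult)
  finally have "cmod (inverse z) * norm x < 1" .
  then have "alg_invertible ((- z) *\<^sub>C (1 - inverse z *\<^sub>C x))"
    using * z by (intro alg_invertible_scaleC alg_invertible_one_minus)
      (auto simp: norm_scaleC)
  also have "(- z) *\<^sub>C (1 - inverse z *\<^sub>C x) = x - z *\<^sub>C 1"
    using z by (simp add: scaleC.scale_right_diff_distrib scaleC_scaleC)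
  finally show False using assms by (simp add: spectrum_def)
qed

lemma closed_spectrum: "closed (spectrum (x::'a::cstar_algebra_1))"
proof -
  have "open (- spectrum x)"
    unfolding open_dist
  proof
    fix z assume "z \<in> - spectrum x"
    then have inv: "alg_invertible (x - z *\<^sub>C 1)" by (simp add: spectrum_def)
    define v where "v = alg_inv (x - z *\<^sub>C 1)"
    note v = alg_inv_inverse[OF inv, folded v_def]
    have "v \<noteq> 0" using v by auto
    have "alg_invertible (x - z' *\<^sub>C 1)" if "dist z' z < 1 / norm v" for z'
    proof -
      have "alg_invertible ((x - z *\<^sub>C 1) - (z' - z) *\<^sub>C 1)"
        by (rule alg_invertible_perturb[OF v])
          (use that \<open>v \<noteq> 0\<close> in \<open>simp add: dist_norm pos_less_divide_eq mult.commute
            del: scaleC.scale_left_diff_distrib\<close>)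
      then show ?thesis by (simp add: scaleC.scale_left_diff_distrib)
    qed
    then show "\<exists>e>0. \<forall>z'. dist z' z < e \<longrightarrow> z' \<in> - spectrum x"
      using \<open>v \<noteq> 0\<close> by (intro exI[of _ "1 / norm v"]) (auto simp: spectrum_def)
  qed
  then show ?thesis by (simp add: closed_def)
qed

lemma compact_spectrum: "compact (spectrum (x::'a::cstar_algebra_1))"
  using closed_spectrum spectrum_cmod_le
  by (meson boundedI compact_eq_bounded_closed)

lemma spectrum_add_scalar:
  "z \<in> spectrum (x + c *\<^sub>C 1) \<longleftrightarrow> z - c \<in> spectrum (x::'a::cstar_algebra_1)"
  by (simp add: spectrum_def scaleC.scale_left_diff_distrib algebra_simps)

lemma spectrum_scaleC:
  assumes "c \<noteq> 0"
  shows "c * z \<in> spectrum (c *\<^sub>C x) \<longleftrightarrow> z \<in> spectrum (x::'a::cstar_algebra_1)"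
proof -
  have *: "alg_invertible (x - z *\<^sub>C 1) \<Longrightarrow> alg_invertible (c *\<^sub>C x - (c * z) *\<^sub>C 1)"
    if "c \<noteq> 0" for c z and x :: 'a
    using alg_invertible_scaleC[OF _ that, of "x - z *\<^sub>C 1"]
    by (simp add: scaleC.scale_right_diff_distrib scaleC_scaleC)
  show ?thesis
    using *[OF assms, of x z] *[of "inverse c" "c *\<^sub>C x" "c * z"] assms
    by (auto simp: spectrum_def scaleC_scaleC simp flip: mult.assoc)
qed

text \<open>The spectral value \<open>z\<close> of \<open>x\<close> gives the spectral value \<open>z + \<i> t\<close> of \<open>x + \<i> t\<close>, whose
  squared norm is at most \<open>norm x ^ 2 + t ^ 2\<close>; for \<open>Im z \<noteq> 0\<close> a suitable real \<open>t\<close> violates this.\<close>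

lemma spectrum_selfadjoint_real:
  fixes x :: "'a::cstar_algebra_1"
  assumes "star x = x" "z \<in> spectrum x"
  shows "Im z = 0"
proof (rule ccontr)
  assume "Im z \<noteq> 0"
  define t where "t = ((norm x)\<^sup>2 + 1) / (2 * Im z)"
  define y where "y = x + (\<i> * of_real t) *\<^sub>C 1"
  have "z + \<i> * of_real t \<in> spectrum y"
    using assms(2) by (simp add: y_def spectrum_add_scalar)
  then have "(cmod (z + \<i> * of_real t))\<^sup>2 \<le> (norm y)\<^sup>2"
    by (intro power_mono spectrum_cmod_le) auto
  also have "\<dots> = norm (star y * y)" by (simp add: cstar_identity)
  also have "star y * y = x * x + (of_real (t\<^sup>2)) *\<^sub>C 1"
    by (simp add: y_def star_add star_scaleC assms algebra_simps mult_scaleC_left mult_scaleC_right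
        scaleC_scaleC power2_eq_square scaleC.scale_minus_left)
  also have "norm \<dots> \<le> (norm x)\<^sup>2 + t\<^sup>2"
    by (rule norm_triangle_le)
      (simp add: norm_mult_ineq power2_eq_square abs_mult flip: of_real_mult)
  finally have "(Re z)\<^sup>2 + (Im z)\<^sup>2 + 2 * Im z * t \<le> (norm x)\<^sup>2"
    by (simp add: cmod_power2 power2_sum algebra_simps)
  moreover have "2 * Im z * t = (norm x)\<^sup>2 + 1"
    using \<open>Im z \<noteq> 0\<close> by (simp add: t_def)
  ultimately show False by (smt (verit) zero_le_power2)
qed

section \<open>The norm of a self-adjoint element\<close>

lemma inverse_one_minus_square:
  fixes y :: "'a::cstar_algebra_1"
  assumes "alg_invertible (1 - y)" "alg_invertible (1 + y)"
  shows "alg_invertible (1 - y * y)"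
    and "alg_inv (1 - y * y) = (1/2) *\<^sub>R (alg_inv (1 - y) + alg_inv (1 + y))"
proof -
  define p q where "p = alg_inv (1 - y)" and "q = alg_inv (1 + y)"
  note p = alg_inv_inverse[OF assms(1), folded p_def]
  note q = alg_inv_inverse[OF assms(2), folded q_def]
  have f: "1 - y * y = (1 - y) * (1 + y)" "1 - y * y = (1 + y) * (1 - y)"
    by (simp_all add: algebra_simps)
  have "(1 - y * y) * p = 1 + y" "(1 - y * y) * q = 1 - y"
    by (simp only: f(2) mult.assoc p mult_1_right, simp only: f(1) mult.assoc q mult_1_right)
  then have 1: "(1 - y * y) * ((1/2) *\<^sub>R (p + q)) = 1"
    by (simp add: distrib_left flip: scaleR_2)
  have "p * (1 - y * y) = 1 + y" "q * (1 - y * y) = 1 - y"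
    by (simp only: f(1) mult.assoc[symmetric] p mult_1_left,
        simp only: f(2) mult.assoc[symmetric] q mult_1_left)
  then have 2: "((1/2) *\<^sub>R (p + q)) * (1 - y * y) = 1"
    by (simp add: distrib_right flip: scaleR_2)
  from 1 2 show "alg_invertible (1 - y * y)"
    unfolding alg_invertible_def by blast
  from 1 2 show "alg_inv (1 - y * y) = (1/2) *\<^sub>R (p + q)"
    by (rule alg_inv_eq)
qed

lemma continuous_on_resolvent:
  fixes x :: "'a::cstar_algebra_1"
  assumes inv: "\<And>z. z \<in> S \<Longrightarrow> alg_invertible (1 - z *\<^sub>C x)"
  shows "continuous_on S (\<lambda>z. alg_inv (1 - z *\<^sub>C x))"
  unfolding continuous_on_iff
proof (intro ballI allI impI)
  fix z e assume z: "z \<in> S" and e: "(0::real) < e"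
  define v where "v = alg_inv (1 - z *\<^sub>C x)"
  define N where "N = norm v + 1"
  define K where "K = norm x + 1"
  have N: "N > 0" "norm v \<le> N" and K: "K > 0" "norm x \<le> K"
    by (simp_all add: N_def K_def add_nonneg_pos)
  define d where "d = min (1 / (2 * N * K)) (e / (4 * N\<^sup>2 * K))"
  have "dist (alg_inv (1 - z' *\<^sub>C x)) v < e" if z': "z' \<in> S" "dist z' z < d" for z'
  proof -
    have eq: "(1 - z *\<^sub>C x) - (1 - z' *\<^sub>C x) = (z' - z) *\<^sub>C x"
      by (simp add: scaleC.scale_left_diff_distrib)
    have "norm ((z' - z) *\<^sub>C x) \<le> dist z' z * K"
      using K by (simp add: norm_scaleC dist_norm mult_left_mono)
    also have "\<dots> \<le> d * K" using z' K by (intro mult_right_mono) auto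
    finally have n: "norm ((z' - z) *\<^sub>C x) \<le> d * K" .
    have "d * K \<le> 1 / (2 * N * K) * K"
      unfolding d_def using K by (intro mult_right_mono) auto
    then have d1: "d * K \<le> 1 / (2 * N)" using K N by simp
    have "d * K \<le> e / (4 * N\<^sup>2 * K) * K"
      unfolding d_def using K by (intro mult_right_mono) auto
    then have d2: "d * K \<le> e / (4 * N\<^sup>2)" using K N by simp
    have "norm ((z' - z) *\<^sub>C x) * norm v \<le> (1 / (2 * N)) * N"
      using n d1 N by (intro mult_mono) auto
    then have half: "norm ((z' - z) *\<^sub>C x) * norm v \<le> 1 / 2" using N by simp
    have "norm (alg_inv (1 - z' *\<^sub>C x) - v) \<le> 2 * (norm v)\<^sup>2 * norm ((z' - z) *\<^sub>C x)"
      using norm_inverse_diff_le[OF alg_inv_inverse[OF inv[OF z]] alg_inv_inverse[OF inv[OF z'(1)]]]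
        half by (simp add: eq v_def)
    also have "\<dots> \<le> 2 * N\<^sup>2 * (e / (4 * N\<^sup>2))"
      using n d2 N e by (intro mult_mono power_mono) auto
    also have "\<dots> = e / 2" using N by simp
    finally show ?thesis using e by (simp add: dist_norm)
  qed
  moreover have "d > 0" using N K e by (simp add: d_def)
  ultimately show "\<exists>d>0. \<forall>z'\<in>S. dist z' z < d \<longrightarrow>
      dist (alg_inv (1 - z' *\<^sub>C x)) (alg_inv (1 - z *\<^sub>C x)) < e"
    unfolding v_def by blast
qed

text \<open>This is the only substantial part of the spectral radius formula that is needed. The proof
  is Rickart's, which avoids complex function theory. If no spectral value lay on the unit circle,
  the functions \<open>R m z = (1 - (z x) ^ 2 ^ m)\<^sup>-\<^sup>1\<close> would exist on the closed disc, and
  they would be equicontinuous, since \<open>R (m + 1) z\<close> is the mean of \<open>R m\<close> at \<open>z\<close> and at a rotation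
  of \<open>z\<close>. For fixed \<open>r < 1\<close> close to 1, \<open>R m r\<close> tends to 1, so \<open>R m 1\<close> comes close to 1 and
  \<open>x ^ 2 ^ m\<close> comes close to 0; but its norm is 1.\<close>

lemma spectrum_meets_unit_circle:
  fixes x :: "'a::cstar_algebra_1"
  assumes sa: "star x = x" and n1: "norm x = 1"
  shows "\<exists>z\<in>spectrum x. cmod z = 1"
proof (rule ccontr)
  assume no: "\<not> (\<exists>z\<in>spectrum x. cmod z = 1)"
  have inv: "alg_invertible (1 - z *\<^sub>C x)" if z: "z \<in> cball 0 1" for z
  proof (cases "z = 0")
    case False
    have "inverse z \<notin> spectrum x"
    proof
      assume s: "inverse z \<in> spectrum x"
      then have "cmod (inverse z) \<le> 1" using spectrum_cmod_le n1 by metis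
      moreover have "1 \<le> cmod (inverse z)"
        using z False by (simp add: norm_inverse one_le_inverse)
      ultimately show False using no s by (auto simp: antisym)
    qed
    then have "alg_invertible ((- z) *\<^sub>C (x - inverse z *\<^sub>C 1))"
      using False by (intro alg_invertible_scaleC) (auto simp: spectrum_def)
    then show ?thesis
      using False by (simp add: scaleC.scale_right_diff_distrib scaleC_scaleC)
  qed (auto simp: alg_invertible_def)
  define R where "R m z = alg_inv (1 - (z *\<^sub>C x) ^ 2 ^ m)" for m z
  have "uniformly_continuous_on (cball 0 1) (\<lambda>z. alg_inv (1 - z *\<^sub>C x))"
    by (intro compact_uniformly_continuous continuous_on_resolvent inv) auto
  then obtain d where d: "d > 0" and unif: "\<And>z z'. z \<in> cball 0 1 \<Longrightarrow> z' \<in> cball 0 1 \<Longrightarrow> dist z' z < d \<Longrightarrow>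
      dist (alg_inv (1 - z' *\<^sub>C x)) (alg_inv (1 - z *\<^sub>C x)) < 1/8"
    unfolding uniformly_continuous_on_def by (metis zero_less_divide_1_iff zero_less_numeral)
  have equi: "(\<forall>z\<in>cball 0 1. alg_invertible (1 - (z *\<^sub>C x) ^ 2 ^ m)) \<and>
      (\<forall>z\<in>cball 0 1. \<forall>z'\<in>cball 0 1. dist z' z < d \<longrightarrow> norm (R m z' - R m z) \<le> 1/8)" for m
  proof (induction m)
    case 0
    show ?case using inv unif by (force simp: R_def dist_norm)
  next
    case (Suc m)
    define w where "w = cis (pi / 2 ^ m)"
    have "cmod w = 1" by (simp add: w_def)
    have "w ^ 2 ^ m = -1" by (simp add: w_def Complex.DeMoivre)
    then have rot: "((w * z) *\<^sub>C x) ^ 2 ^ m = - ((z *\<^sub>C x) ^ 2 ^ m)" for z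
      by (simp add: power_scaleC power_mult_distrib)
    have sq: "(z *\<^sub>C x) ^ 2 ^ Suc m = (z *\<^sub>C x) ^ 2 ^ m * (z *\<^sub>C x) ^ 2 ^ m" for z
      by (simp add: mult_2 power_add)
    have disc: "w * z \<in> cball 0 1" if "z \<in> cball 0 1" for z
      using that \<open>cmod w = 1\<close> by (simp add: norm_mult)
    have i1: "alg_invertible (1 - (z *\<^sub>C x) ^ 2 ^ m)" and
      i2: "alg_invertible (1 + (z *\<^sub>C x) ^ 2 ^ m)" if "z \<in> cball 0 1" for z
      using conjunct1[OF Suc] that disc[OF that] rot[of z] by (blast, metis diff_minus_eq_add)
    \<comment> \<open>Partial fractions: \<open>2 / (1 - v ^ 2) = 1 / (1 - v) + 1 / (1 + v)\<close> for \<open>v = (z x) ^ 2 ^ m\<close>.\<close>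
    have mean: "R (Suc m) z = (1/2) *\<^sub>R (R m z + R m (w * z))" if "z \<in> cball 0 1" for z
      unfolding R_def sq rot inverse_one_minus_square(2)[OF i1[OF that] i2[OF that]] by simp
    show ?case
    proof (intro conjI ballI impI)
      fix z :: complex assume z: "z \<in> cball 0 1"
      show "alg_invertible (1 - (z *\<^sub>C x) ^ 2 ^ Suc m)"
        unfolding sq by (rule inverse_one_minus_square(1)[OF i1[OF z] i2[OF z]])
      fix z' :: complex assume z': "z' \<in> cball 0 1" "dist z' z < d"
      have "dist (w * z') (w * z) = dist z' z"
        using \<open>cmod w = 1\<close> by (simp add: dist_norm norm_mult flip: right_diff_distrib)
      then have b: "norm (R m z' - R m z) \<le> 1/8" "norm (R m (w * z') - R m (w * z)) \<le> 1/8"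
        using conjunct2[OF Suc] z z' disc by auto
      have "R (Suc m) z' - R (Suc m) z =
          (1/2) *\<^sub>R ((R m z' - R m z) + (R m (w * z') - R m (w * z)))"
        by (simp add: mean[OF z] mean[OF z'(1)] algebra_simps)
      then show "norm (R (Suc m) z' - R (Suc m) z) \<le> 1/8"
        using norm_triangle_le[OF add_mono[OF b]] by simp
    qed
  qed
  define r where "r = 1 - min d 1 / 2"
  have r: "0 \<le> r" "r < 1" using d by (auto simp: r_def)
  obtain m where m: "r ^ m < 1/16"
    using real_arch_pow_inv[of "1/16" r] r by auto
  have "r ^ 2 ^ m \<le> r ^ m"
    using r less_exp[of m] by (intro power_decreasing) auto
  with m have "r ^ 2 ^ m \<le> 1/16" by simp
  then have small: "norm ((of_real r *\<^sub>C x) ^ 2 ^ m) \<le> 1/16"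
    using r by (simp add: power_scaleC norm_scaleC norm_power norm_selfadjoint_power_two_power[OF sa] n1)
  have cb: "complex_of_real r \<in> cball 0 1" "(1::complex) \<in> cball 0 1" using r by auto
  have "dist 1 (complex_of_real r) < d"
  proof -
    have "dist 1 (complex_of_real r) = cmod (of_real (1 - r))" by (simp add: dist_norm)
    also have "\<dots> = min d 1 / 2" using d by (simp only: norm_of_real) (simp add: r_def)
    finally show ?thesis using d by auto
  qed
  then have near: "norm (R m 1 - R m (of_real r)) \<le> 1/8"
    using equi[of m] cb by blast
  note invs = conjunct1[OF equi[of m], rule_format]
  \<comment> \<open>Inversion is applied twice near 1: \<open>R m r\<close> is close to 1, hence so is \<open>R m 1\<close>, hence so is
    the inverse \<open>1 - x ^ 2 ^ m\<close> of the latter.\<close>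
  have "norm (R m (of_real r) - 1) \<le> 2 * (norm (1::'a))\<^sup>2 * norm (1 - (1 - (of_real r *\<^sub>C x) ^ 2 ^ m))"
    unfolding R_def
    by (rule norm_inverse_diff_le) (use alg_inv_inverse[OF invs[OF cb(1)]] small in auto)
  with small near have "norm (R m 1 - 1) \<le> 1/4"
    using norm_triangle_ineq[of "R m 1 - R m (of_real r)" "R m (of_real r) - 1"] by simp
  then have v: "norm (1 - R m 1) \<le> 1/4" by (simp add: norm_minus_commute)
  have "norm ((1 - (1 *\<^sub>C x) ^ 2 ^ m) - 1) \<le> 2 * (norm (1::'a))\<^sup>2 * norm (1 - R m 1)"
    by (rule norm_inverse_diff_le)
      (use alg_inv_inverse[OF invs[OF cb(2)]] v in \<open>auto simp: R_def\<close>)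
  with v show False
    by (simp add: norm_selfadjoint_power_two_power[OF sa] n1)
qed

lemma norm_selfadjoint_le:
  fixes x :: "'a::cstar_algebra_1"
  assumes sa: "star x = x" and r: "\<And>z. z \<in> spectrum x \<Longrightarrow> cmod z \<le> r" "0 \<le> r"
  shows "norm x \<le> r"
proof (cases "x = 0")
  case False
  define c where "c = complex_of_real (1 / norm x)"
  have c: "c \<noteq> 0" "cmod c = 1 / norm x" using False by (simp_all add: c_def norm_divide)
  have "star (c *\<^sub>C x) = c *\<^sub>C x" by (simp add: star_scaleC sa c_def)
  moreover have "norm (c *\<^sub>C x) = 1" using False by (simp add: norm_scaleC c)
  ultimately obtain z where z: "z \<in> spectrum (c *\<^sub>C x)" "cmod z = 1"
    using spectrum_meets_unit_circle by blast
  then have "z / c \<in> spectrum x"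
    using spectrum_scaleC[OF c(1), of "z / c" x] c(1) by simp
  from r(1)[OF this] z c show ?thesis by (simp add: norm_divide)
qed (use r in simp)

lemma spectrum_selfadjoint_nonempty:
  fixes x :: "'a::cstar_algebra_1"
  assumes "star x = x"
  shows "spectrum x \<noteq> {}"
proof
  assume e: "spectrum x = {}"
  then have "x = 0" using norm_selfadjoint_le[OF assms, of 0] by auto
  then have "0 \<in> spectrum x" by (auto simp: spectrum_def alg_invertible_def)
  with e show False by simp
qed

section \<open>Functional calculus of a self-adjoint element\<close>

text \<open>The value of a complex polynomial at an element of the algebra, by Horner's scheme.\<close>

definition alg_poly :: "complex poly \<Rightarrow> 'a::cstar_algebra_1 \<Rightarrow> 'a" where
  "alg_poly p h = fold_coeffs (\<lambda>c y. c *\<^sub>C 1 + h * y) p 0"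

lemma alg_poly_0 [simp]: "alg_poly 0 h = 0"
  by (simp add: alg_poly_def)

lemma alg_poly_pCons [simp]: "alg_poly (pCons c p) h = c *\<^sub>C 1 + h * alg_poly p h"
  by (cases "p = 0 \<and> c = 0") (auto simp: alg_poly_def)

lemma alg_poly_add: "alg_poly (p + q) h = alg_poly p h + alg_poly q h"
  by (induction p q rule: poly_induct2) (simp_all add: algebra_simps)

lemma alg_poly_smult: "alg_poly (smult c p) h = c *\<^sub>C alg_poly p h"
  by (induction p) (simp_all add: scaleC_scaleC mult_scaleC_right scaleC_add_right)

lemma alg_poly_diff: "alg_poly (p - q) h = alg_poly p h - alg_poly q h"
  using alg_poly_add[of p "- q" h] alg_poly_smult[of "-1" q h] by simp

lemma alg_poly_mult: "alg_poly (p * q) h = alg_poly p h * alg_poly q h"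
  by (induction p) (simp_all add: alg_poly_add alg_poly_smult algebra_simps mult_scaleC_left)

lemma alg_poly_commute: "h * alg_poly p h = alg_poly p h * h"
  using alg_poly_mult[of "[:0, 1:]" p h] alg_poly_mult[of p "[:0, 1:]" h]
  by (simp add: mult.commute)

lemma star_alg_poly:
  assumes "star h = h"
  shows "star (alg_poly p h) = alg_poly (map_poly cnj p) h"
  by (induction p)
    (simp_all add: map_poly_pCons star_add star_mult star_scaleC assms alg_poly_commute)

text \<open>Factor \<open>q\<close> into linear factors. Nonemptiness of the spectrum excludes the zero polynomial.\<close>

lemma alg_poly_invertible:
  fixes h :: "'a::cstar_algebra_1"
  assumes ne: "spectrum h \<noteq> {}" and "\<And>z. z \<in> spectrum h \<Longrightarrow> poly q z \<noteq> 0"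
  shows "alg_invertible (alg_poly q h)"
  using assms(2)
proof (induction "degree q" arbitrary: q)
  case 0
  then obtain c where q: "q = [:c:]" using degree_eq_zeroE by metis
  with 0 ne have "c \<noteq> 0" by auto
  then have "alg_invertible (c *\<^sub>C (1::'a))"
    by (intro alg_invertible_scaleC) (auto simp: alg_invertible_def)
  then show ?case by (simp add: q)
next
  case (Suc n)
  then have "\<not> constant (poly q)" by (simp add: constant_degree)
  then obtain r where r: "poly q r = 0" using fundamental_theorem_of_algebra by blast
  then obtain q' where q: "q = [:- r, 1:] * q'" by (auto simp: poly_eq_0_iff_dvd)
  have "q' \<noteq> 0" using q Suc(2) by auto
  then have "degree q' = n" using Suc(2) by (simp add: q degree_mult_eq del: mult_pCons_left)
  moreover have "poly q' z \<noteq> 0" if "z \<in> spectrum h" for z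
    using Suc(3)[OF that] by (auto simp: q)
  ultimately have "alg_invertible (alg_poly q' h)" using Suc(1) by blast
  moreover have "alg_invertible (h - r *\<^sub>C 1)"
    using Suc(3)[of r] r by (auto simp: spectrum_def)
  ultimately have "alg_invertible ((h - r *\<^sub>C 1) * alg_poly q' h)"
    by (rule alg_invertible_mult[rotated])
  moreover have "alg_poly q h = (h - r *\<^sub>C 1) * alg_poly q' h"
    by (simp add: q alg_poly_mult del: mult_pCons_left)
  ultimately show ?case by simp
qed

lemma spectrum_alg_poly:
  fixes h :: "'a::cstar_algebra_1"
  assumes ne: "spectrum h \<noteq> {}" and w: "w \<in> spectrum (alg_poly q h)"
  shows "\<exists>z\<in>spectrum h. w = poly q z"
proof (rule ccontr)
  assume *: "\<not> ?thesis"
  have "alg_invertible (alg_poly (q - [:w:]) h)"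
    by (rule alg_poly_invertible[OF ne]) (use * in auto)
  with w show False by (simp add: alg_poly_diff spectrum_def)
qed

lemma cnj_spectrum_selfadjoint:
  fixes h :: "'a::cstar_algebra_1"
  assumes "star h = h" "z \<in> spectrum h"
  shows "cnj z = z" "complex_of_real (Re z) = z"
  using spectrum_selfadjoint_real[OF assms] by (auto simp: complex_eq_iff)

text \<open>The spectrum is real, so \<open>star (p h) * p h\<close> is the value at \<open>h\<close> of a polynomial equal to
  \<open>(cmod (p z))\<^sup>2\<close> on the spectrum. Its norm is bounded by its spectral values, since it is
  self-adjoint.\<close>

lemma norm_alg_poly_le:
  fixes h :: "'a::cstar_algebra_1"
  assumes sa: "star h = h" and M: "\<And>z. z \<in> spectrum h \<Longrightarrow> cmod (poly p z) \<le> M"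
  shows "norm (alg_poly p h) \<le> M"
proof -
  define q where "q = map_poly cnj p * p"
  note ne = spectrum_selfadjoint_nonempty[OF sa]
  have M0: "0 \<le> M" using ne M by (meson all_not_in_conv norm_ge_zero order_trans)
  have q: "alg_poly q h = star (alg_poly p h) * alg_poly p h"
    by (simp add: q_def alg_poly_mult star_alg_poly[OF sa])
  have "norm (alg_poly q h) \<le> M\<^sup>2"
  proof (rule norm_selfadjoint_le)
    show "star (alg_poly q h) = alg_poly q h"
      by (simp add: q star_mult star_star)
    fix w assume "w \<in> spectrum (alg_poly q h)"
    then obtain z where z: "z \<in> spectrum h" "w = poly q z"
      using spectrum_alg_poly[OF ne] by blast
    have "poly (map_poly cnj p) z = cnj (poly p z)"
      using poly_cnj[of p z] cnj_spectrum_selfadjoint(1)[OF sa z(1)] by simp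
    then have "cmod w = (cmod (poly p z))\<^sup>2"
      by (simp add: z q_def norm_mult power2_eq_square)
    then show "cmod w \<le> M\<^sup>2" using M[OF z(1)] by (simp add: power_mono)
  qed simp
  then have "(norm (alg_poly p h))\<^sup>2 \<le> M\<^sup>2" by (simp add: q cstar_identity)
  then show ?thesis using M0 by (rule power2_le_imp_le)
qed

text \<open>\<open>y\<close> is the value at \<open>h\<close> of the function \<open>f\<close>: some sequence of polynomials converges to \<open>f\<close>
  uniformly on the spectrum, and its values at \<open>h\<close> converge to \<open>y\<close>.\<close>

definition has_fun_value :: "'a::cstar_algebra_1 \<Rightarrow> (complex \<Rightarrow> complex) \<Rightarrow> 'a \<Rightarrow> bool" where
  "has_fun_value h f y \<longleftrightarrow> (\<exists>P. uniform_limit (spectrum h) (\<lambda>n. poly (P n)) f sequentially \<and>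
     (\<lambda>n. alg_poly (P n) h) \<longlonglongrightarrow> y)"

lemma has_fun_value_poly: "has_fun_value h (poly p) (alg_poly p h)"
  unfolding has_fun_value_def by (rule exI[of _ "\<lambda>_. p"]) (simp add: uniform_limit_iff)

lemma has_fun_value_unique:
  fixes h :: "'a::cstar_algebra_1"
  assumes sa: "star h = h" and "has_fun_value h f y" "has_fun_value h g y'"
    and fg: "\<And>z. z \<in> spectrum h \<Longrightarrow> f z = g z"
  shows "y = y'"
proof -
  obtain P where P: "uniform_limit (spectrum h) (\<lambda>n. poly (P n)) f sequentially"
    "(\<lambda>n. alg_poly (P n) h) \<longlonglongrightarrow> y" using assms(2) by (auto simp: has_fun_value_def)
  obtain Q where Q: "uniform_limit (spectrum h) (\<lambda>n. poly (Q n)) g sequentially"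
    "(\<lambda>n. alg_poly (Q n) h) \<longlonglongrightarrow> y'" using assms(3) by (auto simp: has_fun_value_def)
  have "norm (y - y') \<le> e" if "e > 0" for e
  proof -
    have "\<forall>\<^sub>F n in sequentially. \<forall>z\<in>spectrum h. dist (poly (P n) z) (f z) < e / 2"
      "\<forall>\<^sub>F n in sequentially. \<forall>z\<in>spectrum h. dist (poly (Q n) z) (g z) < e / 2"
      by (rule uniform_limitD[OF P(1)] uniform_limitD[OF Q(1)]; use \<open>e > 0\<close> in simp)+
    then have "\<forall>\<^sub>F n in sequentially. norm (alg_poly (P n) h - alg_poly (Q n) h) \<le> e"
    proof eventually_elim
      case (elim n)
      have "cmod (poly (P n) z - poly (Q n) z) \<le> e" if z: "z \<in> spectrum h" for z
      proof -
        have "dist (poly (P n) z) (f z) < e / 2" "dist (poly (Q n) z) (f z) < e / 2"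
          using elim z fg[OF z] by auto
        then have "dist (poly (P n) z) (poly (Q n) z) < e"
          by (rule dist_triangle_half_l)
        then show ?thesis by (simp add: dist_norm)
      qed
      then show ?case
        using norm_alg_poly_le[OF sa, of "P n - Q n" e] by (simp add: alg_poly_diff)
    qed
    moreover have "(\<lambda>n. norm (alg_poly (P n) h - alg_poly (Q n) h)) \<longlonglongrightarrow> norm (y - y')"
      by (intro tendsto_intros P Q)
    ultimately show ?thesis
      by (intro tendsto_upperbound) auto
  qed
  then have "norm (y - y') \<le> 0" by (rule field_le_epsilon) simp
  then show ?thesis by simp
qed

lemma Stone_Weierstrass_real_axis:
  fixes f :: "complex \<Rightarrow> complex"
  assumes S: "compact S" "\<And>z. z \<in> S \<Longrightarrow> complex_of_real (Re z) = z"
    and f: "continuous_on S f" and e: "e > 0"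
  shows "\<exists>p. \<forall>z\<in>S. cmod (poly p z - f z) < e"
proof -
  define T where "T = Re ` S"
  have T: "compact T"
    unfolding T_def by (intro compact_continuous_image S continuous_intros)
  have "complex_of_real ` T = S" using S(2) by (force simp: T_def)
  then have "continuous_on T (\<lambda>t. f (of_real t))"
    by (intro continuous_on_compose2[OF f]) (auto intro!: continuous_intros)
  then have c: "continuous_on T (\<lambda>t. Re (f (of_real t)))" "continuous_on T (\<lambda>t. Im (f (of_real t)))"
    by (auto intro!: continuous_intros)
  have real: "\<exists>p. \<forall>t\<in>T. cmod (poly p (of_real t) - of_real (g t)) < e / 2"
    if g: "continuous_on T g" for g
  proof -
    obtain r where r: "real_polynomial_function r" "\<And>t. t \<in> T \<Longrightarrow> \<bar>g t - r t\<bar> < e / 2"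
      using Stone_Weierstrass_real_polynomial_function[OF T g, of "e / 2"] e by auto
    obtain a n where a: "r = (\<lambda>t. \<Sum>i\<le>n. a i * t ^ i)"
      using r(1) unfolding real_polynomial_function_iff_sum by blast
    define p where "p = (\<Sum>i\<le>n. monom (complex_of_real (a i)) i)"
    have "poly p (of_real t) = of_real (r t)" for t
      by (simp add: p_def a poly_sum poly_monom)
    then have "cmod (poly p (of_real t) - of_real (g t)) < e / 2" if "t \<in> T" for t
      using r(2)[OF that] by (simp add: abs_minus_commute flip: of_real_diff)
    then show ?thesis by blast
  qed
  obtain p q where p: "\<forall>t\<in>T. cmod (poly p (of_real t) - of_real (Re (f (of_real t)))) < e / 2"
    and q: "\<forall>t\<in>T. cmod (poly q (of_real t) - of_real (Im (f (of_real t)))) < e / 2"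
    using real[OF c(1)] real[OF c(2)] by blast
  have "cmod (poly (p + smult \<i> q) z - f z) < e" if "z \<in> S" for z
  proof -
    have z: "Re z \<in> T" "complex_of_real (Re z) = z" using that S(2) by (auto simp: T_def)
    have "poly (p + smult \<i> q) z - f z
        = (poly p z - of_real (Re (f z))) + \<i> * (poly q z - of_real (Im (f z)))"
      using complex_eq[of "f z"] by (simp add: algebra_simps)
    also have "cmod \<dots> < e / 2 + e / 2"
      using bspec[OF p z(1)] bspec[OF q z(1)]
      by (intro norm_triangle_lt add_strict_mono) (simp_all add: norm_mult z(2))
    finally show ?thesis by simp
  qed
  then show ?thesis by blast
qed

lemma has_fun_value_exists:
  fixes h :: "'a::cstar_algebra_1"
  assumes sa: "star h = h" and f: "continuous_on (spectrum h) f"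
  shows "\<exists>y. has_fun_value h f y"
proof -
  have "\<exists>p. \<forall>z\<in>spectrum h. cmod (poly p z - f z) < 1 / real (Suc n)" for n
    by (rule Stone_Weierstrass_real_axis[OF compact_spectrum _ f])
      (simp_all add: cnj_spectrum_selfadjoint[OF sa])
  then obtain P where P: "\<And>n z. z \<in> spectrum h \<Longrightarrow> cmod (poly (P n) z - f z) < 1 / real (Suc n)"
    by metis
  have small: "\<exists>N. \<forall>n\<ge>N. 1 / real (Suc n) < e" if "e > 0" for e
    using order_tendstoD(2)[OF LIMSEQ_inverse_real_of_nat that]
    by (simp add: eventually_sequentially inverse_eq_divide)
  have "uniform_limit (spectrum h) (\<lambda>n. poly (P n)) f sequentially"
  proof (rule uniform_limitI)
    fix e :: real assume "e > 0"
    then obtain N where N: "\<And>n. n \<ge> N \<Longrightarrow> 1 / real (Suc n) < e" using small by blast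
    then have "\<forall>z\<in>spectrum h. dist (poly (P n) z) (f z) < e" if "n \<ge> N" for n
      using P[of _ n] N[OF that] by (auto simp: dist_norm intro: order.strict_trans)
    then show "\<forall>\<^sub>F n in sequentially. \<forall>z\<in>spectrum h. dist (poly (P n) z) (f z) < e"
      unfolding eventually_sequentially by blast
  qed
  moreover have "Cauchy (\<lambda>n. alg_poly (P n) h)"
  proof (rule metric_CauchyI)
    fix e :: real assume "e > 0"
    then obtain N where N: "\<And>n. n \<ge> N \<Longrightarrow> 1 / real (Suc n) < e / 3"
      using small[of "e / 3"] by auto
    have "dist (alg_poly (P m) h) (alg_poly (P n) h) < e" if "m \<ge> N" "n \<ge> N" for m n
    proof -
      have "cmod (poly (P m - P n) z) \<le> 2 * e / 3" if "z \<in> spectrum h" for z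
        using P[OF that, of m] P[OF that, of n] N[OF \<open>m \<ge> N\<close>] N[OF \<open>n \<ge> N\<close>]
          norm_triangle_ineq4[of "poly (P m) z - f z" "poly (P n) z - f z"] by simp
      then have "norm (alg_poly (P m - P n) h) \<le> 2 * e / 3"
        by (rule norm_alg_poly_le[OF sa])
      then show ?thesis using \<open>e > 0\<close> by (simp add: alg_poly_diff dist_norm)
    qed
    then show "\<exists>N. \<forall>m\<ge>N. \<forall>n\<ge>N. dist (alg_poly (P m) h) (alg_poly (P n) h) < e" by blast
  qed
  ultimately show ?thesis
    unfolding has_fun_value_def by (meson Cauchy_convergent convergent_def)
qed

lemma has_fun_value_add:
  assumes "has_fun_value h f y" "has_fun_value h g y'"
  shows "has_fun_value h (\<lambda>z. f z + g z) (y + y')"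
proof -
  obtain P Q where "uniform_limit (spectrum h) (\<lambda>n. poly (P n)) f sequentially"
    "(\<lambda>n. alg_poly (P n) h) \<longlonglongrightarrow> y" "uniform_limit (spectrum h) (\<lambda>n. poly (Q n)) g sequentially"
    "(\<lambda>n. alg_poly (Q n) h) \<longlonglongrightarrow> y'" using assms by (auto simp: has_fun_value_def)
  then show ?thesis unfolding has_fun_value_def
    by (intro exI[of _ "\<lambda>n. P n + Q n"])
      (simp add: uniform_limit_add tendsto_add alg_poly_add poly_add[abs_def])
qed

lemma has_fun_value_mult:
  fixes h :: "'a::cstar_algebra_1"
  assumes "has_fun_value h f y" "has_fun_value h g y'"
    and "continuous_on (spectrum h) f" "continuous_on (spectrum h) g"
  shows "has_fun_value h (\<lambda>z. f z * g z) (y * y')"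
proof -
  obtain P Q where "uniform_limit (spectrum h) (\<lambda>n. poly (P n)) f sequentially"
    "(\<lambda>n. alg_poly (P n) h) \<longlonglongrightarrow> y" "uniform_limit (spectrum h) (\<lambda>n. poly (Q n)) g sequentially"
    "(\<lambda>n. alg_poly (Q n) h) \<longlonglongrightarrow> y'" using assms by (auto simp: has_fun_value_def)
  moreover have "bounded (f ` spectrum h)" "bounded (g ` spectrum h)"
    using assms(3,4) by (auto intro!: compact_imp_bounded compact_continuous_image compact_spectrum)
  ultimately show ?thesis unfolding has_fun_value_def
    by (intro exI[of _ "\<lambda>n. P n * Q n"])
      (simp add: uniform_lim_mult tendsto_mult alg_poly_mult poly_mult[abs_def])
qed

lemma has_fun_value_cnj:
  fixes h :: "'a::cstar_algebra_1"
  assumes sa: "star h = h" and "has_fun_value h f y"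
  shows "has_fun_value h (\<lambda>z. cnj (f z)) (star y)"
proof -
  obtain P where P: "uniform_limit (spectrum h) (\<lambda>n. poly (P n)) f sequentially"
    "(\<lambda>n. alg_poly (P n) h) \<longlonglongrightarrow> y" using assms by (auto simp: has_fun_value_def)
  have *: "poly (map_poly cnj p) z = cnj (poly p z)" if "z \<in> spectrum h" for p z
    using poly_cnj[of p z] cnj_spectrum_selfadjoint(1)[OF sa that] by simp
  have "dist (poly (map_poly cnj p) z) (cnj (f z)) = dist (poly p z) (f z)"
    if "z \<in> spectrum h" for p z
    unfolding *[OF that] dist_norm complex_cnj_diff[symmetric] complex_mod_cnj ..
  then have "uniform_limit (spectrum h) (\<lambda>n. poly (map_poly cnj (P n))) (\<lambda>z. cnj (f z)) sequentially"
    using P(1) unfolding uniform_limit_iff by (simp cong: ball_cong)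
  moreover have "(\<lambda>n. alg_poly (map_poly cnj (P n)) h) \<longlonglongrightarrow> star y"
    using P(2) unfolding tendsto_iff
    by (simp add: dist_norm flip: star_alg_poly[OF sa] star_diff)
  ultimately show ?thesis unfolding has_fun_value_def
    by (intro exI[of _ "\<lambda>n. map_poly cnj (P n)"]) simp
qed

theorem functional_calculus_exists:
  fixes h :: "'a::cstar_algebra_1"
  assumes sa: "star h = h"
  shows "\<exists>\<Phi>. functional_calculus h \<Phi>"
proof -
  define \<Phi> where "\<Phi> f = (SOME y. has_fun_value h f y)" for f
  have val: "has_fun_value h f (\<Phi> f)" if "continuous_on (spectrum h) f" for f
    unfolding \<Phi>_def using has_fun_value_exists[OF sa that] by (rule someI_ex)
  have eq: "\<Phi> f = y" if "has_fun_value h f y" "continuous_on (spectrum h) f" for f y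
    using has_fun_value_unique[OF sa val that(1)] that(2) by blast
  have const: "has_fun_value h (\<lambda>z. c) (c *\<^sub>C 1)" for c
    using has_fun_value_poly[of h "[:c:]"] by (simp add: poly_pCons[abs_def])
  have "functional_calculus h \<Phi>"
    unfolding functional_calculus_def
  proof (intro conjI allI impI)
    fix f g :: "complex \<Rightarrow> complex" and c :: complex
    assume f: "continuous_on (spectrum h) f"
    have "has_fun_value h (\<lambda>z. c * f z) (c *\<^sub>C 1 * \<Phi> f)"
      by (rule has_fun_value_mult[OF const val[OF f] continuous_on_const f])
    then have "\<Phi> (\<lambda>z. c * f z) = c *\<^sub>C 1 * \<Phi> f"
      by (rule eq) (intro continuous_intros f)
    then show "\<Phi> (\<lambda>z. c * f z) = c *\<^sub>C \<Phi> f"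
      by (simp add: mult_scaleC_left)
    show "\<Phi> (\<lambda>z. cnj (f z)) = star (\<Phi> f)"
      by (rule eq[OF has_fun_value_cnj[OF sa val[OF f]]]) (intro continuous_intros f)
    assume g: "continuous_on (spectrum h) g"
    show "\<Phi> (\<lambda>z. f z + g z) = \<Phi> f + \<Phi> g"
      by (rule eq[OF has_fun_value_add[OF val[OF f] val[OF g]]]) (intro continuous_intros f g)
    show "\<Phi> (\<lambda>z. f z * g z) = \<Phi> f * \<Phi> g"
      by (rule eq[OF has_fun_value_mult[OF val[OF f] val[OF g] f g]]) (intro continuous_intros f g)
    assume fg: "\<forall>z\<in>spectrum h. f z = g z"
    show "\<Phi> f = \<Phi> g"
      by (rule has_fun_value_unique[OF sa val[OF f] val[OF g] bspec[OF fg]])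
  next
    show "\<Phi> (\<lambda>z. 1) = 1"
      using eq[OF const continuous_on_const, of 1] by (simp only: scaleC.scale_one)
    have "has_fun_value h (\<lambda>z. z) h"
      using has_fun_value_poly[of h "[:0, 1:]"] by (simp add: poly_pCons[abs_def])
    then show "\<Phi> (\<lambda>z. z) = h"
      by (rule eq) (rule continuous_on_id)
  qed
  then show ?thesis by blast
qed

lemma functional_calculus:
  fixes h :: "'a::cstar_algebra_1" and f g :: "complex \<Rightarrow> complex"
  assumes "functional_calculus h \<Phi>" "continuous_on (spectrum h) f"
  shows functional_calculus_scale: "\<Phi> (\<lambda>z. c * f z) = c *\<^sub>C \<Phi> f"
    and functional_calculus_cnj: "\<Phi> (\<lambda>z. cnj (f z)) = star (\<Phi> f)"
    and functional_calculus_cong: "continuous_on (spectrum h) g \<Longrightarrow>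
      (\<And>z. z \<in> spectrum h \<Longrightarrow> f z = g z) \<Longrightarrow> \<Phi> f = \<Phi> g"
    and functional_calculus_add: "continuous_on (spectrum h) g \<Longrightarrow>
      \<Phi> (\<lambda>z. f z + g z) = \<Phi> f + \<Phi> g"
    and functional_calculus_mult: "continuous_on (spectrum h) g \<Longrightarrow>
      \<Phi> (\<lambda>z. f z * g z) = \<Phi> f * \<Phi> g"
proof -
  note \<Phi> = assms(1)[unfolded functional_calculus_def]
  note one = \<Phi>[THEN conjunct2, THEN conjunct1, THEN spec, THEN spec, THEN mp, OF assms(2)]
  note two = \<Phi>[THEN conjunct1, THEN spec, THEN spec, THEN mp, THEN mp, OF assms(2)]
  show "\<Phi> (\<lambda>z. c * f z) = c *\<^sub>C \<Phi> f" by (rule conjunct1[OF one])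
  show "\<Phi> (\<lambda>z. cnj (f z)) = star (\<Phi> f)" by (rule conjunct2[OF one])
  assume "continuous_on (spectrum h) g"
  note two = two[OF this]
  show "\<Phi> (\<lambda>z. f z + g z) = \<Phi> f + \<Phi> g" by (rule conjunct1[OF conjunct2[OF two]])
  show "\<Phi> (\<lambda>z. f z * g z) = \<Phi> f * \<Phi> g" by (rule conjunct2[OF conjunct2[OF two]])
  assume "\<And>z. z \<in> spectrum h \<Longrightarrow> f z = g z"
  then show "\<Phi> f = \<Phi> g" by (intro conjunct1[OF two, THEN mp] ballI)
qed

lemma functional_calculus_one_id:
  assumes "functional_calculus h \<Phi>"
  shows functional_calculus_one: "\<Phi> (\<lambda>z. 1) = 1"
    and functional_calculus_id: "\<Phi> (\<lambda>z. z) = h"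
  using assms unfolding functional_calculus_def by simp_all

lemma functional_calculus_minus:
  assumes "functional_calculus h \<Phi>" "continuous_on (spectrum h) f"
  shows "\<Phi> (\<lambda>z. - f z) = - \<Phi> f"
  using functional_calculus_scale[OF assms, of "-1"] by simp

lemma functional_calculus_diff:
  assumes "functional_calculus h \<Phi>" "continuous_on (spectrum h) f" "continuous_on (spectrum h) g"
  shows "\<Phi> (\<lambda>z. f z - g z) = \<Phi> f - \<Phi> g"
  using functional_calculus_add[OF assms(1,2), of "\<lambda>z. - g z"] functional_calculus_minus[OF assms(1,3)]
  by (simp add: continuous_on_minus assms(3))

section \<open>The cone of positive elements\<close>

lemma spectrum_scalar_diff:
  "w \<in> spectrum (c *\<^sub>C 1 - x) \<longleftrightarrow> c - w \<in> spectrum (x::'a::cstar_algebra_1)"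
  using spectrum_scaleC[of "-1" "c - w" x] spectrum_add_scalar[of w "- x" c] by simp

lemma cstar_positiveI_norm:
  fixes x :: "'a::cstar_algebra_1"
  assumes "star x = x" "norm (t *\<^sub>R 1 - x) \<le> t"
  shows "cstar_positive x"
  unfolding cstar_positive_def
proof (intro conjI subsetI)
  fix z assume z: "z \<in> spectrum x"
  then have "of_real t - z \<in> spectrum (of_real t *\<^sub>C 1 - x)"
    by (simp add: spectrum_scalar_diff)
  then have "cmod (of_real t - z) \<le> norm (of_real t *\<^sub>C 1 - x)"
    by (rule spectrum_cmod_le)
  then have "cmod (of_real t - z) \<le> t"
    using assms(2) by (simp add: scaleC_of_real)
  then have "Re z \<ge> 0"
    using abs_Re_le_cmod[of "of_real t - z"] by simp
  moreover have "z = of_real (Re z)"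
    using cnj_spectrum_selfadjoint(2)[OF assms(1) z] by simp
  ultimately show "z \<in> complex_of_real ` {0..}" by blast
qed (rule assms)

lemma norm_scalar_diff_positive_le:
  fixes x :: "'a::cstar_algebra_1"
  assumes "cstar_positive x" "norm x \<le> t"
  shows "norm (t *\<^sub>R 1 - x) \<le> t"
proof (rule norm_selfadjoint_le)
  have sa: "star x = x" using assms by (simp add: cstar_positive_def)
  then show "star (t *\<^sub>R 1 - x) = t *\<^sub>R 1 - x"
    by (simp add: star_diff star_scaleR)
  fix w assume "w \<in> spectrum (t *\<^sub>R 1 - x)"
  then have w: "of_real t - w \<in> spectrum x"
    by (simp add: spectrum_scalar_diff flip: scaleC_of_real)
  then obtain s where s: "of_real t - w = complex_of_real s" "s \<ge> 0"
    using assms(1) by (auto simp: cstar_positive_def)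
  have "\<bar>s\<bar> \<le> t" using spectrum_cmod_le[OF w] assms(2) s by simp
  moreover have "w = of_real (t - s)" using s by (simp add: algebra_simps)
  ultimately have "cmod w = \<bar>t - s\<bar>" "\<bar>s\<bar> \<le> t" by (simp_all only: norm_of_real)
  then show "cmod w \<le> t" using s(2) by linarith
next
  show "0 \<le> t" using assms(2) norm_ge_zero order_trans by blast
qed

text \<open>This description of positivity, free of the spectrum, makes the positive elements a closed
  convex cone.\<close>

lemma cstar_positive_iff_norm:
  "cstar_positive (x::'a::cstar_algebra_1) \<longleftrightarrow> star x = x \<and> norm (norm x *\<^sub>R 1 - x) \<le> norm x"
  using cstar_positiveI_norm[of x "norm x"] norm_scalar_diff_positive_le[of x "norm x"]
  unfolding cstar_positive_def by blast

lemma cstar_positive_add: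
  fixes x y :: "'a::cstar_algebra_1"
  assumes "cstar_positive x" "cstar_positive y"
  shows "cstar_positive (x + y)"
proof (rule cstar_positiveI_norm)
  show "star (x + y) = x + y" using assms by (simp add: cstar_positive_def star_add)
  have "(norm x + norm y) *\<^sub>R 1 - (x + y) = (norm x *\<^sub>R 1 - x) + (norm y *\<^sub>R 1 - y)"
    by (simp add: algebra_simps)
  then show "norm ((norm x + norm y) *\<^sub>R 1 - (x + y)) \<le> norm x + norm y"
    using assms by (simp only: cstar_positive_iff_norm norm_triangle_le add_mono)
qed

lemma cstar_positive_scaleR:
  fixes x :: "'a::cstar_algebra_1"
  assumes "cstar_positive x" "0 \<le> r"
  shows "cstar_positive (r *\<^sub>R x)"
proof (rule cstar_positiveI_norm)
  show "star (r *\<^sub>R x) = r *\<^sub>R x" using assms by (simp add: cstar_positive_def star_scaleR)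
  have "(r * norm x) *\<^sub>R 1 - r *\<^sub>R x = r *\<^sub>R (norm x *\<^sub>R 1 - x)"
    by (simp add: algebra_simps)
  then show "norm ((r * norm x) *\<^sub>R 1 - r *\<^sub>R x) \<le> r * norm x"
    using assms by (simp add: cstar_positive_iff_norm mult_left_mono)
qed

lemma closed_cstar_positive: "closed {x::'a::cstar_algebra_1. cstar_positive x}"
proof -
  have "continuous_on UNIV (star :: 'a \<Rightarrow> 'a)"
    unfolding continuous_on_iff dist_norm star_diff[symmetric] norm_star by blast
  then have "closed {x::'a. star x = x}"
    by (intro closed_Collect_eq continuous_intros)
  moreover have "closed {x::'a. norm (norm x *\<^sub>R 1 - x) \<le> norm x}"
    by (intro closed_Collect_le continuous_intros)
  ultimately show ?thesis
    unfolding cstar_positive_iff_norm by (rule closed_Collect_conj)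
qed

lemma cstar_positive_square:
  fixes u :: "'a::cstar_algebra_1"
  assumes sa: "star u = u"
  shows "cstar_positive (u * u)"
  unfolding cstar_positive_def
proof (intro conjI subsetI)
  show sa2: "star (u * u) = u * u" by (simp add: star_mult sa)
  fix z assume z: "z \<in> spectrum (u * u)"
  define s where "s = Re z"
  have zs: "z = of_real s"
    using cnj_spectrum_selfadjoint(2)[OF sa2 z] by (simp add: s_def)
  have "s \<ge> 0"
  proof (rule ccontr)
    assume "\<not> s \<ge> 0"
    define w where "w = \<i> * of_real (sqrt (- s))"
    have "w * w = - of_real (sqrt (- s) * sqrt (- s))"
      unfolding w_def of_real_mult by (simp add: algebra_simps)
    also have "\<dots> = z" using \<open>\<not> s \<ge> 0\<close> by (simp add: zs)
    finally have w: "w * w = z" "Im w \<noteq> 0" "Im (- w) \<noteq> 0"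
      using \<open>\<not> s \<ge> 0\<close> by (simp_all add: w_def)
    then have "w \<notin> spectrum u" "- w \<notin> spectrum u"
      using spectrum_selfadjoint_real[OF sa] by blast+
    then have "alg_invertible ((u - w *\<^sub>C 1) * (u - (- w) *\<^sub>C 1))"
      by (intro alg_invertible_mult) (auto simp: spectrum_def)
    also have "(u - w *\<^sub>C 1) * (u - (- w) *\<^sub>C 1) = u * u - z *\<^sub>C 1"
      by (simp add: algebra_simps mult_scaleC_left mult_scaleC_right scaleC_scaleC w)
    finally show False using z by (simp add: spectrum_def)
  qed
  then show "z \<in> complex_of_real ` {0..}" by (simp add: zs)
qed

text \<open>Jacobson's argument: if \<open>w\<close> inverts \<open>y x - z\<close>, then \<open>(x w y - 1) / z\<close> inverts \<open>x y - z\<close>.\<close>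

lemma spectrum_mult_commute:
  fixes x y :: "'a::cstar_algebra_1"
  assumes z: "z \<noteq> 0" "z \<in> spectrum (x * y)"
  shows "z \<in> spectrum (y * x)"
proof (rule ccontr)
  assume "z \<notin> spectrum (y * x)"
  then obtain w where w: "(y * x - z *\<^sub>C 1) * w = 1" "w * (y * x - z *\<^sub>C 1) = 1"
    by (auto simp: spectrum_def alg_invertible_def)
  define v where "v = inverse z *\<^sub>C (x * w * y - 1)"
  have "(x * y - z *\<^sub>C 1) * (x * w * y - 1) = x * ((y * x - z *\<^sub>C 1) * w) * y - x * y + z *\<^sub>C 1"
    by (simp add: algebra_simps mult_scaleC_left mult_scaleC_right)
  then have 1: "(x * y - z *\<^sub>C 1) * v = 1"
    using z(1) by (simp add: v_def w mult_scaleC_right scaleC_scaleC)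
  have "(x * w * y - 1) * (x * y - z *\<^sub>C 1) = x * (w * (y * x - z *\<^sub>C 1)) * y - x * y + z *\<^sub>C 1"
    by (simp add: algebra_simps mult_scaleC_left mult_scaleC_right)
  then have 2: "v * (x * y - z *\<^sub>C 1) = 1"
    using z(1) by (simp add: v_def w mult_scaleC_left scaleC_scaleC)
  from 1 2 z(2) show False by (auto simp: spectrum_def alg_invertible_def)
qed

lemma cstar_positive_mult_commute:
  fixes x y :: "'a::cstar_algebra_1"
  assumes "cstar_positive (x * y)" "star (y * x) = y * x"
  shows "cstar_positive (y * x)"
  unfolding cstar_positive_def
proof (intro conjI subsetI)
  fix z assume z: "z \<in> spectrum (y * x)"
  show "z \<in> complex_of_real ` {0..}"
  proof (cases "z = 0")
    case True
    then show ?thesis by (intro image_eqI[of _ _ 0]) auto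
  next
    case False
    then have "z \<in> spectrum (x * y)" using z by (rule spectrum_mult_commute)
    then show ?thesis using assms(1) unfolding cstar_positive_def by blast
  qed
qed (rule assms)

lemma cstar_positive_antisym:
  fixes x :: "'a::cstar_algebra_1"
  assumes "cstar_positive x" "cstar_positive (- x)"
  shows "x = 0"
proof -
  have "norm x \<le> 0"
  proof (rule norm_selfadjoint_le)
    show "star x = x" using assms by (simp add: cstar_positive_def)
    fix z assume "z \<in> spectrum x"
    moreover from this have "- z \<in> spectrum (- x)"
      using spectrum_scaleC[of "-1" z x] by simp
    ultimately have "z \<in> complex_of_real ` {0..}" "- z \<in> complex_of_real ` {0..}"
      using assms unfolding cstar_positive_def by blast+
    then obtain s t where "z = of_real s" "- z = of_real t" "s \<ge> 0" "t \<ge> 0" by auto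
    moreover from this have "s = - t" by (metis minus_equation_iff of_real_eq_iff of_real_minus)
    ultimately show "cmod z \<le> 0" by simp
  qed simp
  then show ?thesis by simp
qed

text \<open>With \<open>h = star x * x\<close> and \<open>s\<close> the square root of the negative part of \<open>h\<close>, the
  element \<open>y = x * s\<close> satisfies \<open>star y * y = s * h * s = - s ^ 4\<close>. Hence \<open>- (star y * y)\<close> and, by
  commuting the factors, \<open>- (y * star y)\<close> are positive. Since \<open>star y * y + y * star y\<close> is positive
  as well, \<open>star y * y\<close> vanishes, and so does the negative part of \<open>h\<close>.\<close>

theorem cstar_positive_star_mult:
  fixes x :: "'a::cstar_algebra_1"
  shows "cstar_positive (star x * x)"
proof -
  define h where "h = star x * x"
  have sa: "star h = h" by (simp add: h_def star_mult star_star)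
  obtain \<Phi> where \<Phi>: "functional_calculus h \<Phi>" using functional_calculus_exists[OF sa] by blast
  define f g where "f z = complex_of_real (sqrt (max 0 (- Re z)))"
    and "g z = complex_of_real (sqrt (max 0 (Re z)))" for z
  have cont: "continuous_on S f" "continuous_on S g" for S
    unfolding f_def g_def by (intro continuous_intros)+
  define s where "s = \<Phi> f"
  define q where "q = s * s"
  have "star s = s"
    using functional_calculus_cnj[OF \<Phi> cont(1)] by (simp add: s_def f_def[abs_def])
  then have saq: "star q = q" by (simp add: q_def star_mult)
  have "star (\<Phi> g) = \<Phi> g"
    using functional_calculus_cnj[OF \<Phi> cont(2)] by (simp add: g_def[abs_def])
  define y where "y = x * s"
  have "star y * y = s * (h * s)"
    by (simp add: y_def h_def star_mult \<open>star s = s\<close> mult.assoc)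
  also have "\<dots> = \<Phi> (\<lambda>z. f z * (z * f z))"
    using cont by (simp add: functional_calculus_mult[OF \<Phi>] functional_calculus_id[OF \<Phi>]
        s_def continuous_intros)
  also have "\<dots> = \<Phi> (\<lambda>z. - ((f z * f z) * (f z * f z)))"
  proof (rule functional_calculus_cong[OF \<Phi>])
    fix z assume z: "z \<in> spectrum h"
    define t where "t = Re z"
    have zt: "z = of_real t"
      using cnj_spectrum_selfadjoint(2)[OF sa z] by (simp add: t_def)
    have ff: "f z * f z = of_real (max 0 (- t))"
      by (simp add: f_def t_def flip: of_real_mult)
    have "f z * (z * f z) = (f z * f z) * z" by simp
    also have "\<dots> = - ((f z * f z) * (f z * f z))"
      unfolding ff by (subst zt, cases "t \<ge> 0") (simp_all add: max_def)
    finally show "f z * (z * f z) = - ((f z * f z) * (f z * f z))" .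
  qed (intro continuous_intros cont)+
  also have "\<dots> = - (q * q)"
    by (simp add: functional_calculus_minus[OF \<Phi>] functional_calculus_mult[OF \<Phi>]
        cont continuous_intros q_def s_def)
  finally have yy: "star y * y = - (q * q)" .
  then have neg: "cstar_positive ((- star y) * y)"
    using cstar_positive_square[OF saq] by simp
  then have neg': "cstar_positive (y * (- star y))"
    by (rule cstar_positive_mult_commute) (simp add: star_mult star_minus star_star)
  \<comment> \<open>Twice the self-adjoint parts of \<open>y\<close>, up to sign.\<close>
  define U V where "U = y + star y" and "V = \<i> *\<^sub>C (y - star y)"
  have "star U = U" "star V = V"
    by (simp_all add: U_def V_def star_add star_diff star_star star_scaleC add.commute
        scaleC.scale_right_diff_distrib)
  then have "cstar_positive ((1/2) *\<^sub>R (U * U + V * V) + y * (- star y))"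
    by (intro cstar_positive_add cstar_positive_scaleR cstar_positive_square neg') auto
  moreover have "U * U + V * V = 2 *\<^sub>R (star y * y + y * star y)"
    by (simp add: U_def V_def mult_scaleC_left mult_scaleC_right scaleC_scaleC algebra_simps scaleR_2)
  ultimately have "cstar_positive (star y * y)" by simp
  with neg have "star y * y = 0" by (intro cstar_positive_antisym) simp_all
  then have "norm (star q * q) = 0" using yy saq by simp
  then have "q = 0" by (simp add: cstar_identity)
  have "h = h + q" by (simp add: \<open>q = 0\<close>)
  also have "\<dots> = \<Phi> (\<lambda>z. z + f z * f z)"
    using cont by (simp add: functional_calculus_add[OF \<Phi>] functional_calculus_mult[OF \<Phi>]
        functional_calculus_id[OF \<Phi>] q_def s_def continuous_intros)
  also have "\<dots> = \<Phi> (\<lambda>z. g z * g z)"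
  proof (rule functional_calculus_cong[OF \<Phi>])
    fix z assume z: "z \<in> spectrum h"
    have "f z * f z = of_real (max 0 (- Re z))" "g z * g z = of_real (max 0 (Re z))"
      by (simp_all add: f_def g_def flip: of_real_mult)
    moreover have "complex_of_real (Re z) + of_real (max 0 (- Re z)) = of_real (max 0 (Re z))"
      unfolding of_real_add[symmetric] by (simp add: max_def)
    ultimately show "z + f z * f z = g z * g z"
      using cnj_spectrum_selfadjoint(2)[OF sa z] by simp
  qed (intro continuous_intros cont)+
  also have "\<dots> = \<Phi> g * \<Phi> g"
    by (simp add: functional_calculus_mult[OF \<Phi>] cont)
  finally show ?thesis
    using cstar_positive_square[OF \<open>star (\<Phi> g) = \<Phi> g\<close>] unfolding h_def by (simp only:)
qed

text \<open>This is \<open>ln t \<le> t - 1\<close> under the functional calculus. Only existence of a functional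
  calculus is needed: whichever one \<open>cfc\<close> selects, the rules above hold for it.\<close>

lemma minus_one_minus_cstar_log_eq_square:
  fixes h :: "'a::cstar_algebra_1"
  assumes h: "cstar_positive h" "alg_invertible h"
  shows "\<exists>g. star g = g \<and> h - 1 - cstar_log h = g * g"
proof -
  define \<Phi> where "\<Phi> = (SOME \<Phi>. functional_calculus h \<Phi>)"
  have sa: "star h = h" using h by (simp add: cstar_positive_def)
  have \<Phi>: "functional_calculus h \<Phi>"
    unfolding \<Phi>_def using functional_calculus_exists[OF sa] by (rule someI_ex)
  have spec: "Im z = 0 \<and> Re z > 0" if "z \<in> spectrum h" for z
  proof -
    have "z \<noteq> 0" using that h(2) by (auto simp: spectrum_def)
    then show ?thesis using that h(1) by (auto simp: cstar_positive_def)
  qed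
  define k where "k z = complex_of_real (sqrt (Re z - 1 - ln (Re z)))" for z
  have ln: "continuous_on (spectrum h) ln"
    by (rule continuous_on_Ln) (use spec in \<open>fastforce simp: complex_nonpos_Reals_iff\<close>)
  have k: "continuous_on (spectrum h) k"
    unfolding k_def by (intro continuous_intros) (use spec in force)
  have "h - 1 - cstar_log h = h - (1 + \<Phi> ln)"
    by (simp add: cstar_log_def cfc_def \<Phi>_def)
  also have "\<dots> = \<Phi> (\<lambda>z. z - (1 + ln z))"
    using ln by (simp add: functional_calculus_add[OF \<Phi>] functional_calculus_diff[OF \<Phi>]
        functional_calculus_one[OF \<Phi>] functional_calculus_id[OF \<Phi>] continuous_intros)
  also have "\<dots> = \<Phi> (\<lambda>z. k z * k z)"
  proof (rule functional_calculus_cong[OF \<Phi>])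
    fix z assume z: "z \<in> spectrum h"
    define t where "t = Re z"
    have t: "z = of_real t" "t > 0" using spec[OF z] by (auto simp: t_def complex_eq_iff)
    then have "t - 1 - ln t \<ge> 0" using ln_le_minus_one[of t] by simp
    then have "k z * k z = of_real (t - 1 - ln t)"
      by (simp add: k_def t_def flip: of_real_mult)
    then show "z - (1 + ln z) = k z * k z"
      using t by (simp add: Ln_of_real)
  qed (intro continuous_intros ln k)+
  also have "\<dots> = \<Phi> k * \<Phi> k" by (rule functional_calculus_mult[OF \<Phi> k k])
  finally have "h - 1 - cstar_log h = \<Phi> k * \<Phi> k" .
  moreover have "star (\<Phi> k) = \<Phi> k"
    using functional_calculus_cnj[OF \<Phi> k] by (simp add: k_def[abs_def])
  ultimately show ?thesis by blast
qed

lemma alg_inv_star: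
  fixes c :: "'a::cstar_algebra_1"
  assumes "alg_invertible c"
  shows "alg_inv (star c) = star (alg_inv c)"
  by (rule alg_inv_eq) (simp_all add: assms alg_inv_inverse flip: star_mult)

text \<open>With \<open>h\<close> the argument of the logarithm, \<open>star a * h * a = star b * b\<close>, so this element is
  \<open>star a * (h - 1 - log h) * a\<close>.\<close>

lemma cstar_positive_relative_log:
  fixes a b :: "'a::cstar_algebra_1"
  assumes a: "alg_invertible a" and b: "alg_invertible b"
  shows "cstar_positive (star b * b - star a * a -
    star a * cstar_log (alg_inv (star a) * star b * b * alg_inv a) * a)"
proof -
  define c where "c = b * alg_inv a"
  define h where "h = star c * c"
  have h: "alg_inv (star a) * star b * b * alg_inv a = h"
    by (simp add: h_def c_def star_mult alg_inv_star[OF a] mult.assoc)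
  have star_inv: "alg_invertible (star y)" if "alg_invertible y" for y :: 'a
    using that unfolding alg_invertible_def by (metis star_mult star_one)
  have "alg_invertible (alg_inv a)"
    unfolding alg_invertible_def using alg_inv_inverse[OF a] by blast
  then have "alg_invertible h"
    unfolding h_def c_def by (intro alg_invertible_mult star_inv b)
  then obtain g where g: "star g = g" "h - 1 - cstar_log h = g * g"
    using minus_one_minus_cstar_log_eq_square[of h] cstar_positive_star_mult[of c] by (auto simp: h_def)
  have "c * a = b" by (simp add: c_def mult.assoc alg_inv_inverse[OF a])
  then have "star a * h * a = star b * b"
    by (metis h_def mult.assoc star_mult)
  then have "star b * b - star a * a - star a * cstar_log h * a = star a * (h - 1 - cstar_log h) * a"
    by (simp add: algebra_simps)
  also have "\<dots> = star (g * a) * (g * a)"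
    by (simp add: g star_mult mult.assoc)
  finally show ?thesis using cstar_positive_star_mult[of "g * a"] by (simp add: h)
qed

section \<open>Integration against closed convex cones\<close>

text \<open>A form of the Bochner integral without measurability of \<open>f\<close> or of \<open>norm (f x - s i x)\<close>: the
  error of the simple approximations \<open>s i\<close> is only required to be bounded by measurable functions
  \<open>u i\<close> whose integrals tend to 0. Unlike Borel measurability of functions into a nonseparable space,
  this notion is closed under differences.\<close>

definition has_upper_integral :: "'x measure \<Rightarrow> ('x \<Rightarrow> 'b::real_normed_vector) \<Rightarrow> 'b \<Rightarrow> bool" where
  "has_upper_integral M f J \<longleftrightarrow> (\<exists>s u.
     (\<forall>i. Bochner_Integration.simple_bochner_integrable M (s i)) \<and>
     (\<forall>i. u i \<in> borel_measurable M) \<and>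
     (\<forall>i. \<forall>x\<in>space M. ennreal (norm (f x - s i x)) \<le> u i x) \<and>
     (\<lambda>i. \<integral>\<^sup>+x. u i x \<partial>M) \<longlonglongrightarrow> 0 \<and>
     (\<lambda>i. Bochner_Integration.simple_bochner_integral M (s i)) \<longlonglongrightarrow> J)"

lemma has_banach_integral_imp_upper:
  fixes f :: "'x \<Rightarrow> 'b::real_normed_vector"
  assumes "has_banach_integral M f J"
  shows "has_upper_integral M f J"
  using assms
proof cases
  case (1 s)
  have [measurable]: "f \<in> borel_measurable M" by (rule 1)
  \<comment> \<open>\<open>f - s i\<close> itself need not be treated as a difference of measurable functions: \<open>s i\<close> takes
    finitely many values.\<close>
  have "(\<lambda>x. ennreal (norm (f x - s i x))) \<in> borel_measurable M" for i
  proof -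
    have sf: "simple_function M (s i)"
      using 1(2)[of i] by (rule simple_bochner_integrable.cases)
    then have [measurable]: "s i \<in> measurable M (count_space UNIV)"
      by (rule measurable_simple_function)
    have "s i \<in> measurable M (count_space (s i ` space M))"
      using sf by (auto simp: simple_function_def measurable_count_space_eq2)
    moreover have "countable (s i ` space M)"
      using sf by (simp add: simple_function_def countable_finite)
    moreover have "(\<lambda>x. ennreal (norm (f x - c))) \<in> borel_measurable M" for c
    proof -
      have "(\<lambda>y. norm (y - c)) \<in> borel_measurable borel"
        by (intro borel_measurable_continuous_onI continuous_intros)
      from measurable_compose[OF _ this, of f M] show ?thesis by simp
    qed
    ultimately show ?thesis
      using measurable_compose_countable'[where f="\<lambda>c x. ennreal (norm (f x - c))" and g="s i"
          and I="s i ` space M" and M=M and N=borel] by simp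
  qed
  with 1 show ?thesis
    unfolding has_upper_integral_def
    by (intro exI[of _ s] exI[of _ "\<lambda>i x. ennreal (norm (f x - s i x))"]) simp
qed

lemma has_upper_integral_diff:
  fixes f g :: "'x \<Rightarrow> 'b::real_normed_vector"
  assumes "has_upper_integral M f I" "has_upper_integral M g J"
  shows "has_upper_integral M (\<lambda>x. f x - g x) (I - J)"
proof -
  obtain s u where s: "\<And>i. Bochner_Integration.simple_bochner_integrable M (s i)" "\<And>i. u i \<in> borel_measurable M"
    "\<And>i x. x \<in> space M \<Longrightarrow> ennreal (norm (f x - s i x)) \<le> u i x"
    "(\<lambda>i. \<integral>\<^sup>+x. u i x \<partial>M) \<longlonglongrightarrow> 0" "(\<lambda>i. Bochner_Integration.simple_bochner_integral M (s i)) \<longlonglongrightarrow> I"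
    using assms(1) unfolding has_upper_integral_def by blast
  obtain t v where t: "\<And>i. Bochner_Integration.simple_bochner_integrable M (t i)" "\<And>i. v i \<in> borel_measurable M"
    "\<And>i x. x \<in> space M \<Longrightarrow> ennreal (norm (g x - t i x)) \<le> v i x"
    "(\<lambda>i. \<integral>\<^sup>+x. v i x \<partial>M) \<longlonglongrightarrow> 0" "(\<lambda>i. Bochner_Integration.simple_bochner_integral M (t i)) \<longlonglongrightarrow> J"
    using assms(2) unfolding has_upper_integral_def by blast
  have "ennreal (norm (f x - g x - (s i x - t i x))) \<le> u i x + v i x" if "x \<in> space M" for i x
  proof -
    have "norm (f x - g x - (s i x - t i x)) \<le> norm (f x - s i x) + norm (g x - t i x)"
      using norm_triangle_ineq4[of "f x - s i x" "g x - t i x"] by (simp add: algebra_simps)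
    then have "ennreal (norm (f x - g x - (s i x - t i x)))
        \<le> ennreal (norm (f x - s i x)) + ennreal (norm (g x - t i x))"
      by (metis ennreal_leI ennreal_plus norm_ge_zero)
    also have "\<dots> \<le> u i x + v i x" using s(3) t(3) that by (intro add_mono)
    finally show ?thesis .
  qed
  moreover have "(\<lambda>i. \<integral>\<^sup>+x. u i x + v i x \<partial>M) \<longlonglongrightarrow> 0"
    using tendsto_add[OF s(4) t(4)] by (simp add: nn_integral_add s(2) t(2))
  moreover have "(\<lambda>i. Bochner_Integration.simple_bochner_integral M (\<lambda>x. s i x - t i x)) \<longlonglongrightarrow> I - J"
    using tendsto_diff[OF s(5) t(5)] by (simp add: simple_bochner_integral_diff s(1) t(1))
  moreover have "Bochner_Integration.simple_bochner_integrable M (\<lambda>x. s i x - t i x)" for i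
    by (rule simple_bochner_integrable_compose2) (simp_all add: s(1) t(1))
  ultimately show ?thesis
    unfolding has_upper_integral_def
    by (intro exI[of _ "\<lambda>i x. s i x - t i x"] exI[of _ "\<lambda>i x. u i x + v i x"])
      (use s(2) t(2) in auto)
qed

lemma infdist_cone_add:
  fixes C :: "'b::real_normed_vector set"
  assumes C: "C \<noteq> {}" "\<And>v w. v \<in> C \<Longrightarrow> w \<in> C \<Longrightarrow> v + w \<in> C"
  shows "infdist (x + y) C \<le> infdist x C + infdist y C"
proof -
  have "infdist (x + y) C - dist y w \<le> infdist x C" if w: "w \<in> C" for w
    unfolding infdist_notempty[OF C(1), of x]
  proof (rule cINF_greatest[OF C(1)])
    fix v assume "v \<in> C"
    then have "infdist (x + y) C \<le> dist (x + y) (v + w)" using C(2) w by (intro infdist_le) auto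
    also have "\<dots> \<le> dist x v + dist y w" by (rule dist_triangle_add)
    finally show "infdist (x + y) C - dist y w \<le> dist x v" by simp
  qed
  then have "infdist (x + y) C - infdist x C \<le> infdist y C"
    unfolding infdist_notempty[OF C(1), of y] by (intro cINF_greatest[OF C(1)]) (simp add: algebra_simps)
  then show ?thesis by simp
qed

lemma infdist_cone_scaleR:
  fixes C :: "'b::real_normed_vector set"
  assumes C: "0 \<in> C" "\<And>r v. v \<in> C \<Longrightarrow> 0 \<le> r \<Longrightarrow> r *\<^sub>R v \<in> C" and r: "0 \<le> r"
  shows "infdist (r *\<^sub>R x) C \<le> r * infdist x C"
proof (cases "r = 0")
  case False
  have "C \<noteq> {}" using C by blast
  have "infdist (r *\<^sub>R x) C / r \<le> infdist x C"
    unfolding infdist_notempty[OF \<open>C \<noteq> {}\<close>, of x]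
  proof (rule cINF_greatest[OF \<open>C \<noteq> {}\<close>])
    fix v assume "v \<in> C"
    then have "infdist (r *\<^sub>R x) C \<le> dist (r *\<^sub>R x) (r *\<^sub>R v)" using C(2) r by (intro infdist_le) auto
    also have "\<dots> = r * dist x v" using r by (simp add: dist_norm flip: scaleR_diff_right)
    finally show "infdist (r *\<^sub>R x) C / r \<le> dist x v"
      using r False by (simp add: divide_le_eq mult.commute)
  qed
  then show ?thesis using r False by (simp add: divide_le_eq mult.commute)
qed (use C in \<open>simp add: infdist_zero\<close>)

text \<open>The distance to the cone is sublinear, so its value at the integral of a simple function is at
  most the integral of its values; the latter is at most the approximation error. This replaces
  the usual separation argument.\<close>

lemma has_upper_integral_in_cone:
  fixes C :: "'b::real_normed_vector set"
  assumes cl: "closed C" and C: "0 \<in> C" "\<And>v w. v \<in> C \<Longrightarrow> w \<in> C \<Longrightarrow> v + w \<in> C"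
    "\<And>r v. v \<in> C \<Longrightarrow> 0 \<le> r \<Longrightarrow> r *\<^sub>R v \<in> C"
    and f: "has_upper_integral M f J" "\<And>x. x \<in> space M \<Longrightarrow> f x \<in> C"
  shows "J \<in> C"
proof -
  have ne: "C \<noteq> {}" using C by blast
  obtain s u where s: "\<And>i. Bochner_Integration.simple_bochner_integrable M (s i)" "\<And>i. u i \<in> borel_measurable M"
    "\<And>i x. x \<in> space M \<Longrightarrow> ennreal (norm (f x - s i x)) \<le> u i x"
    "(\<lambda>i. \<integral>\<^sup>+x. u i x \<partial>M) \<longlonglongrightarrow> 0" "(\<lambda>i. Bochner_Integration.simple_bochner_integral M (s i)) \<longlonglongrightarrow> J"
    using f(1) unfolding has_upper_integral_def by blast
  have sum_le: "infdist (\<Sum>y\<in>A. r y *\<^sub>R y) C \<le> (\<Sum>y\<in>A. r y * infdist y C)"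
    if "finite A" "\<And>y. 0 \<le> r y" for A and r :: "'b \<Rightarrow> real"
    using that(1)
  proof (induction A)
    case (insert a A)
    have "infdist (r a *\<^sub>R a + (\<Sum>y\<in>A. r y *\<^sub>R y)) C
        \<le> infdist (r a *\<^sub>R a) C + infdist (\<Sum>y\<in>A. r y *\<^sub>R y) C"
      by (rule infdist_cone_add[OF ne C(2)])
    also have "\<dots> \<le> r a * infdist a C + (\<Sum>y\<in>A. r y * infdist y C)"
      by (intro add_mono infdist_cone_scaleR[OF C(1,3)] that(2) insert.IH)
    finally show ?case using insert by simp
  qed (simp add: C(1))
  have le: "ennreal (infdist (Bochner_Integration.simple_bochner_integral M (s i)) C) \<le> (\<integral>\<^sup>+x. u i x \<partial>M)" for i
  proof -
    have sf: "simple_function M (s i)"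
      using s(1)[of i] by (rule simple_bochner_integrable.cases)
    have int: "Bochner_Integration.simple_bochner_integrable M (\<lambda>x. infdist (s i x) C)"
      by (rule simple_bochner_integrable_compose2[where p="\<lambda>v w. infdist v C" and g="s i"])
        (simp_all add: C(1) s(1))
    have "infdist (Bochner_Integration.simple_bochner_integral M (s i)) C
        \<le> (\<Sum>y\<in>s i ` space M. measure M {x\<in>space M. s i x = y} * infdist y C)"
      unfolding simple_bochner_integral_def
      using sf by (intro sum_le) (auto simp: simple_function_def)
    also have "\<dots> = Bochner_Integration.simple_bochner_integral M (\<lambda>x. infdist (s i x) C)"
      by (subst simple_bochner_integral_partition[OF int sf, where v="\<lambda>y. infdist y C"]) auto
    finally have "ennreal (infdist (Bochner_Integration.simple_bochner_integral M (s i)) C)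
        \<le> ennreal (Bochner_Integration.simple_bochner_integral M (\<lambda>x. infdist (s i x) C))"
      by (rule ennreal_leI)
    also have "\<dots> = (\<integral>\<^sup>+x. infdist (s i x) C \<partial>M)"
      by (rule simple_bochner_integral_eq_nn_integral[OF int]) (rule infdist_nonneg)
    also have "\<dots> \<le> (\<integral>\<^sup>+x. u i x \<partial>M)"
    proof (rule nn_integral_mono)
      fix x assume x: "x \<in> space M"
      have "infdist (s i x) C \<le> norm (f x - s i x)"
        using infdist_le[OF f(2)[OF x], of "s i x"] by (simp add: dist_norm norm_minus_commute)
      then show "ennreal (infdist (s i x) C) \<le> u i x"
        using s(3)[OF x, of i] by (meson ennreal_leI order_trans)
    qed
    finally show ?thesis .
  qed
  have "(\<lambda>i. ennreal (infdist (Bochner_Integration.simple_bochner_integral M (s i)) C))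
      \<longlonglongrightarrow> ennreal (infdist J C)"
    by (intro tendsto_ennrealI tendsto_infdist s(5))
  then have "ennreal (infdist J C) \<le> 0"
    by (rule tendsto_le[OF trivial_limit_sequentially s(4)]) (simp add: le)
  then have "infdist J C = 0" using infdist_nonneg[of J C] by (simp add: ennreal_eq_0_iff)
  then show ?thesis using in_closed_iff_infdist_zero[OF cl ne] by simp
qed

lemma has_banach_integral_unique:
  fixes f :: "'x \<Rightarrow> 'b::real_normed_vector"
  assumes "has_banach_integral M f I" "has_banach_integral M f J"
  shows "I = J"
proof -
  have "has_upper_integral M (\<lambda>x. f x - f x) (I - J)"
    by (intro has_upper_integral_diff has_banach_integral_imp_upper assms)
  then have "I - J \<in> {0}"
    by (rule has_upper_integral_in_cone[rotated -2]) auto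
  then show ?thesis by simp
qed

lemma banach_integral_eqI:
  fixes f :: "'x \<Rightarrow> 'b::real_normed_vector"
  assumes "has_banach_integral M f J"
  shows "banach_integral M f = J"
  unfolding banach_integral_def
  using assms has_banach_integral_unique by (auto intro!: the_equality)

lemma has_banach_integral_density:
  assumes "density_in M d"
  shows "has_banach_integral M (\<lambda>x. star (d x) * d x) 1"
proof -
  have eq: "banach_integral M (\<lambda>x. star (d x) * d x) = 1"
    using assms by (simp add: density_in_def)
  then obtain J where J: "has_banach_integral M (\<lambda>x. star (d x) * d x) J"
    unfolding banach_integral_def by (auto split: if_splits)
  with eq show ?thesis using banach_integral_eqI[OF J] by simp
qed

section \<open>Nonpositivity of the integrated logarithm\<close>

theorem proposition6p1:
  fixes \<mu> :: "'x::t2_space measure"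
    and a b :: "'x \<Rightarrow>\<^sub>C 'a::cstar_algebra_1"
  assumes "locally_compact_space (euclidean :: 'x topology)"
    and "sets \<mu> = sets borel"
    and "density_in \<mu> a"
    and "density_in \<mu> b"
    and "\<forall>x. alg_invertible (a x)"
    and "\<forall>x. alg_invertible (b x)"
  shows "banach_integral \<mu>
           (\<lambda>x. star (a x) *
                cstar_log (alg_inv (star (a x)) * star (b x) * b x * alg_inv (a x)) *
                a x) \<preceq> 0"
proof -
  define f where "f x = star (a x) *
    cstar_log (alg_inv (star (a x)) * star (b x) * b x * alg_inv (a x)) * a x" for x
  have pos0: "cstar_positive (0::'a)"
    using cstar_positive_square[of "0::'a"] by simp
  have "cstar_positive (0 - banach_integral \<mu> f)"
  proof (cases "\<exists>J. has_banach_integral \<mu> f J")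
    case True
    then obtain J where J: "has_banach_integral \<mu> f J" by blast
    have "has_upper_integral \<mu> (\<lambda>x. star (b x) * b x - star (a x) * a x - f x) (1 - 1 - J)"
      by (intro has_upper_integral_diff has_banach_integral_imp_upper has_banach_integral_density assms J)
    then have "1 - 1 - J \<in> {y. cstar_positive y}"
      by (rule has_upper_integral_in_cone[OF closed_cstar_positive, rotated -2])
        (use assms in \<open>auto simp: f_def pos0 cstar_positive_relative_log
          intro: cstar_positive_add cstar_positive_scaleR\<close>)
    then show ?thesis by (simp add: banach_integral_eqI[OF J])
  next
    case False
    \<comment> \<open>Without a Bochner integral the value is 0 by convention.\<close>
    then show ?thesis by (simp add: banach_integral_def pos0)
  qed
  then show ?thesis by (simp add: cstar_le_def f_def[abs_def])
qed

end
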